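(* Let $A=\mathbb{k}Q/I$ be a toupie algebra with the special basis $S$ of $I$. Write each relation $\rho\in S$ as $$\rho=\beta_0+\sum_{i=1}^kc_i\beta_i$$ with $\beta_0,\dots,\beta_k$ distinct paths, $c_i\ne0$, $c_0=1$, and $l(\beta_{i_1})\ge l(\beta_{i_2})$ for $i_1\le i_2$. Then there exists $0\le k_0\le k$ such that $l(\beta_j)=l(\beta_{k_0})$ for all $j\ge k_0$; take the smallest such $k_0$ and put $$\rho'=\beta_{k_0}+\sum_{i=k_0+1}^kc_{k_0}^{-1}c_i\beta_i.$$ Then the associated graded algebra $gr(A)$ is isomorphic to $\mathbb{k}Q/I'$, where $I'$ is an admissible ideal whose generating relations are obtained from those of $I$ (the elements of $S$) by replacing each $\rho$ by $\rho'$.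
   Context: $\mathbb{k}$ is a field of characteristic zero; $l(p)$ is the length of a path $p$. **Toupie algebras.** A finite quiver $Q$ is toupie if it has a unique source $0$ and a unique sink $\omega$ and any other vertex is the source of exactly one arrow and the target of exactly one arrow. A toupie algebra is $A=\mathbb{k}Q/I$ with $Q$ toupie and $I$ an admissible ideal. Branches are the paths from $0$ to $\omega$. Let $\alpha^{(a+l+m+1)},\dots,\alpha^{(a+l+m+n)}$ be the branches involved in non monomial relations, ordered with non-increasing lengths; here $a$, $l$, $m$ are the numbers of branches that are arrows, that have length $>1$ and are not involved in any relation, and that contain monomial relations, respectively. The non monomial relations are taken as $\rho_i=\alpha^{(a+l+m+k_i)}+\sum_{j>k_i}a_{ij}\alpha^{(a+l+m+j)}$, $1\le i\le r$, whose coefficient matrix $C\in\mathbb{k}^{r\times n}$ is in reduced row echelon form of rank $r$. $\mathcal{G}=\mathcal{G}_{mon}\sqcup\{\rho_i\mid 1\le i\le r\}$ is a minimal set of generators of $I$, with $\mathcal{G}_{mon}$ consisting of monomial relations. **Special basis.** Operate on $C$ by row transformations as follows. - Consider the rightmost nonzero column, number $q_0$, of $C_0:=C$, and let its bottom-most nonzero entry be in row $l_0$. Use this entry to reduce to zero all entries of column $q_0$ in rows $l'<l_0$; this gives a matrix $C_1$. - Consider the rightmost nonzero column, number $q_1$, of $C_1$ with $q_1<q_0$. Consider the bottom-most nonzero entry of this column, in row $l_1$ say, such that all entries of row $l_1$ in columns $q''>q_1$ are zero. If no entry of the column fits this condition, the operation ends. Otherwise, use this entry to reduce to zero all entries of column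 $q_1$ in rows $l'<l_1$; this gives a matrix $C_2$. - Repeat these operations. Since $C$ has finitely many columns, the process terminates and gives a unique matrix $C'$. The rows of $C'$ correspond to a set $\mathcal{G}'_{nomon}$ of non monomial generating relations of $I$, and the special basis of $I$ in $\mathbb{k}Q$ is the generating set $S=\mathcal{G}_{mon}\cup\mathcal{G}'_{nomon}$. **Associated graded algebra.** With $\mathfrak{r}=\mathrm{rad}(A)$ the Jacobson radical, $gr(A)=A/\mathfrak{r}\oplus\mathfrak{r}/\mathfrak{r}^2\oplus\cdots\oplus\mathfrak{r}^t/\mathfrak{r}^{t+1}\oplus\cdots$ with product $(x+\mathfrak{r}^{m+1})(y+\mathfrak{r}^{n+1})=xy+\mathfrak{r}^{m+n+1}$ for $x\in\mathfrak{r}^m$, $y\in\mathfrak{r}^n$.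
   Formalization: In the special basis construction, a column with no fitting entry is skipped and the process goes on to the next column (stopping there makes the lemma false); the branch numbering is read as a partition: branches in non monomial relations contain no monomial relation. *)

theory Defs
  imports
    "HOL-Algebra.QuotRing"
    "HOL-Algebra.Ideal_Product"
    "HOL-Algebra.Module"
    "HOL-Library.Poly_Mapping"
    "HOL-Library.Sublist"
    "Graph_Theory.Arc_Walk"
    "Jordan_Normal_Form.Gauss_Jordan_Elimination"
    "Jordan_Normal_Form.DL_Rank"
begin

section \<open>Path algebras\<close>

text \<open>
  A quiver is a multigraph \<open>pre_digraph\<close>: \<open>tail e\<close> is the source of the arrow \<open>e\<close> and
  \<open>head e\<close> is its target.  A path is a triple (start, arrows in the order in which they
  are traversed, end); the trivial path at \<open>v\<close> is \<open>(v, [], v)\<close>.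
\<close>

type_synonym ('v, 'e) path = "'v \<times> 'e list \<times> 'v"

definition quiver_paths :: "('v, 'e) pre_digraph \<Rightarrow> ('v, 'e) path set" where
  "quiver_paths Q = {(u, p, v). pre_digraph.awalk Q u p v}"

definition path_length :: "('v, 'e) path \<Rightarrow> nat" where
  "path_length p = length (fst (snd p))"

text \<open>
  The product of two basis paths is their concatenation \<open>p q\<close> (first \<open>p\<close>, then \<open>q\<close>)
  if \<open>p\<close> ends where \<open>q\<close> starts, and \<open>0\<close> otherwise.
\<close>

definition path_mult ::
  "('v, 'e) path \<Rightarrow> ('v, 'e) path \<Rightarrow> 'k::field_char_0 \<Rightarrow> ('v, 'e) path \<Rightarrow>\<^sub>0 'k" where
  "path_mult p q c =
     (if snd (snd p) = fst q
      then Poly_Mapping.single (fst p, fst (snd p) @ fst (snd q), snd (snd q)) c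
      else 0)"

definition path_algebra ::
  "('v, 'e) pre_digraph \<Rightarrow> ('k::field_char_0, ('v, 'e) path \<Rightarrow>\<^sub>0 'k) module" where
  "path_algebra Q =
     \<lparr>carrier = {x. Poly_Mapping.keys x \<subseteq> quiver_paths Q},
      mult = (\<lambda>x y. \<Sum>p\<in>Poly_Mapping.keys x. \<Sum>q\<in>Poly_Mapping.keys y.
                path_mult p q (Poly_Mapping.lookup x p * Poly_Mapping.lookup y q)),
      one = (\<Sum>v\<in>verts Q. Poly_Mapping.single (v, [], v) 1),
      zero = 0,
      add = (+),
      smult = (\<lambda>c. Poly_Mapping.map ((*) c))\<rparr>"


section \<open>Ideals, quotient algebras, Jacobson radical, associated graded algebra\<close>

text \<open>
  In this section \<open>R\<close> and \<open>A\<close> are associative unital algebras, not necessarily commutative,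
  over the field of scalars \<open>UNIV :: 'k set\<close>; ideals are two-sided unless said otherwise.
\<close>

primrec ideal_power :: "('a, 'm) ring_scheme \<Rightarrow> 'a set \<Rightarrow> nat \<Rightarrow> 'a set" where
  "ideal_power R J 0 = carrier R"
| "ideal_power R J (Suc t) = ideal_prod R J (ideal_power R J t)"

definition minimal_generators :: "('a, 'm) ring_scheme \<Rightarrow> 'a set \<Rightarrow> 'a set \<Rightarrow> bool" where
  "minimal_generators R G I \<longleftrightarrow>
     G \<subseteq> carrier R \<and> Idl\<^bsub>R\<^esub> G = I \<and> (\<forall>G'. G' \<subset> G \<longrightarrow> Idl\<^bsub>R\<^esub> G' \<noteq> I)"

definition coset_smult :: "('k, 'a, 'm) module_scheme \<Rightarrow> 'a set \<Rightarrow> 'k \<Rightarrow> 'a set \<Rightarrow> 'a set" where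
  "coset_smult A J c X = (\<Union>x\<in>X. J +>\<^bsub>A\<^esub> (c \<odot>\<^bsub>A\<^esub> x))"

definition quotient_algebra ::
  "('k, 'a, 'm) module_scheme \<Rightarrow> 'a set \<Rightarrow> ('k, 'a set) module" where
  "quotient_algebra A J = ring.extend (A Quot J) (module.fields (coset_smult A J))"

definition algebra_isomorphic ::
  "('k, 'a, 'm) module_scheme \<Rightarrow> ('k, 'b, 'n) module_scheme \<Rightarrow> bool" where
  "algebra_isomorphic A B \<longleftrightarrow>
     (\<exists>\<phi>\<in>ring_iso A B. \<forall>c. \<forall>x\<in>carrier A. \<phi> (c \<odot>\<^bsub>A\<^esub> x) = c \<odot>\<^bsub>B\<^esub> \<phi> x)"

definition left_ideal :: "'a set \<Rightarrow> ('a, 'm) ring_scheme \<Rightarrow> bool" where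
  "left_ideal J R \<longleftrightarrow>
     additive_subgroup J R \<and> (\<forall>a\<in>carrier R. \<forall>x\<in>J. a \<otimes>\<^bsub>R\<^esub> x \<in> J)"

definition maximal_left_ideal :: "'a set \<Rightarrow> ('a, 'm) ring_scheme \<Rightarrow> bool" where
  "maximal_left_ideal J R \<longleftrightarrow>
     left_ideal J R \<and> J \<noteq> carrier R \<and>
     (\<forall>K. left_ideal K R \<longrightarrow> J \<subseteq> K \<longrightarrow> K = J \<or> K = carrier R)"

definition jacobson_radical :: "('a, 'm) ring_scheme \<Rightarrow> 'a set" where
  "jacobson_radical R = carrier R \<inter> \<Inter>{J. maximal_left_ideal J R}"

abbreviation rad_power :: "('a, 'm) ring_scheme \<Rightarrow> nat \<Rightarrow> 'a set" where
  "rad_power R t \<equiv> ideal_power R (jacobson_radical R) t"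

text \<open>
  An element of \<open>gr(A)\<close> is a sequence \<open>X\<close> whose entry \<open>X t\<close> is a coset of \<open>rad_power A (t+1)\<close>
  in \<open>rad_power A t\<close>, almost all entries being the zero coset.  For homogeneous \<open>x + r^(i+1)\<close>
  and \<open>y + r^(j+1)\<close> the coset \<open>xy + r^(i+j+1)\<close> is \<open>rcoset_mult A (r^(i+j+1))\<close> of the two
  factors; the component of degree \<open>t\<close> of a general product is the sum over \<open>i + j = t\<close>.
\<close>

definition associated_graded ::
  "('k, 'a, 'm) module_scheme \<Rightarrow> ('k, nat \<Rightarrow> 'a set) module" where
  "associated_graded A =
     \<lparr>carrier = {X. (\<forall>t. \<exists>x\<in>rad_power A t. X t = rad_power A (Suc t) +>\<^bsub>A\<^esub> x) \<and>
                    finite {t. X t \<noteq> rad_power A (Suc t)}},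
      mult = (\<lambda>X Y t. finsum (A Quot rad_power A (Suc t))
                (\<lambda>i. rcoset_mult A (rad_power A (Suc t)) (X i) (Y (t - i))) {..t}),
      one = (\<lambda>t. if t = 0 then rad_power A 1 +>\<^bsub>A\<^esub> \<one>\<^bsub>A\<^esub> else rad_power A (Suc t)),
      zero = (\<lambda>t. rad_power A (Suc t)),
      add = (\<lambda>X Y t. X t <+>\<^bsub>A\<^esub> Y t),
      smult = (\<lambda>c X t. coset_smult A (rad_power A (Suc t)) c (X t))\<rparr>"

definition arrow_ideal ::
  "('v, 'e) pre_digraph \<Rightarrow> (('v, 'e) path \<Rightarrow>\<^sub>0 'k::field_char_0) set" where
  "arrow_ideal Q =
     Idl\<^bsub>path_algebra Q\<^esub> ((\<lambda>e. Poly_Mapping.single (tail Q e, [e], head Q e) 1) ` arcs Q)"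

definition admissible_ideal ::
  "('v, 'e) pre_digraph \<Rightarrow> (('v, 'e) path \<Rightarrow>\<^sub>0 'k::field_char_0) set \<Rightarrow> bool" where
  "admissible_ideal Q I \<longleftrightarrow>
     ideal I (path_algebra Q) \<and>
     I \<subseteq> ideal_power (path_algebra Q) (arrow_ideal Q) 2 \<and>
     (\<exists>N\<ge>2. ideal_power (path_algebra Q) (arrow_ideal Q) N \<subseteq> I)"


section \<open>Toupie quivers\<close>

definition toupie_quiver :: "('v, 'e) pre_digraph \<Rightarrow> 'v \<Rightarrow> 'v \<Rightarrow> bool" where
  "toupie_quiver Q v0 \<omega> \<longleftrightarrow>
     fin_digraph Q \<and>
     {v \<in> verts Q. in_arcs Q v = {}} = {v0} \<and>
     {v \<in> verts Q. out_arcs Q v = {}} = {\<omega>} \<and>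
     (\<forall>v \<in> verts Q - {v0, \<omega>}. out_degree Q v = 1 \<and> in_degree Q v = 1)"

definition branches :: "('v, 'e) pre_digraph \<Rightarrow> 'v \<Rightarrow> 'v \<Rightarrow> ('v, 'e) path set" where
  "branches Q v0 \<omega> = {p \<in> quiver_paths Q. fst p = v0 \<and> snd (snd p) = \<omega>}"

text \<open>A monomial relation is identified with its path; \<open>M\<close> is a set of such paths, of
  positive length.\<close>

definition contains_monomial :: "('v, 'e) path set \<Rightarrow> ('v, 'e) path \<Rightarrow> bool" where
  "contains_monomial M b \<longleftrightarrow> (\<exists>p\<in>M. sublist (fst (snd p)) (fst (snd b)))"

definition monomials :: "('v, 'e) path set \<Rightarrow> (('v, 'e) path \<Rightarrow>\<^sub>0 'k::field_char_0) set" where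
  "monomials M = (\<lambda>p. Poly_Mapping.single p 1) ` M"

text \<open>The relation given by row \<open>i\<close> of a matrix whose column \<open>j\<close> belongs to the branch \<open>\<gamma> j\<close>;
  rows and columns are counted from \<open>0\<close>.\<close>

definition row_relation ::
  "(nat \<Rightarrow> ('v, 'e) path) \<Rightarrow> 'k::field_char_0 mat \<Rightarrow> nat \<Rightarrow> ('v, 'e) path \<Rightarrow>\<^sub>0 'k" where
  "row_relation \<gamma> C i = (\<Sum>j<dim_col C. Poly_Mapping.single (\<gamma> j) (C $$ (i, j)))"

definition involved_branches ::
  "('v, 'e) path set \<Rightarrow> (nat \<Rightarrow> ('v, 'e) path) \<Rightarrow> 'k::field_char_0 mat \<Rightarrow> ('v, 'e) path set" where
  "involved_branches B \<gamma> C =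
     {b \<in> B. \<exists>i<dim_row C. b \<in> Poly_Mapping.keys (row_relation \<gamma> C i)}"


section \<open>The special basis\<close>

text \<open>
  The columns are treated from right to left.  For column \<open>q\<close>, the candidates are the rows with
  a nonzero entry in column \<open>q\<close> and zeros to the right of it; the bottom-most candidate is used
  to clear column \<open>q\<close> in the rows above it.  Without a candidate (in particular for a zero
  column) the matrix is left unchanged, and the procedure goes on with the next column.
\<close>

definition candidate_rows :: "'k::field_char_0 mat \<Rightarrow> nat \<Rightarrow> nat set" where
  "candidate_rows C q =
     {i. i < dim_row C \<and> C $$ (i, q) \<noteq> 0 \<and> (\<forall>q'. q < q' \<and> q' < dim_col C \<longrightarrow> C $$ (i, q') = 0)}"

definition clear_above :: "nat \<Rightarrow> nat \<Rightarrow> 'k::field_char_0 mat \<Rightarrow> 'k mat" where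
  "clear_above q l C =
     mat (dim_row C) (dim_col C)
       (\<lambda>(i, j). if i < l then C $$ (i, j) - C $$ (i, q) / C $$ (l, q) * C $$ (l, j)
                 else C $$ (i, j))"

definition special_step :: "nat \<Rightarrow> 'k::field_char_0 mat \<Rightarrow> 'k mat" where
  "special_step q C =
     (if candidate_rows C q = {} then C else clear_above q (Max (candidate_rows C q)) C)"

definition special_matrix :: "'k::field_char_0 mat \<Rightarrow> 'k mat" where
  "special_matrix C = fold special_step (rev [0..<dim_col C]) C"

definition special_basis ::
  "('v, 'e) path set \<Rightarrow> (nat \<Rightarrow> ('v, 'e) path) \<Rightarrow> 'k::field_char_0 mat
     \<Rightarrow> (('v, 'e) path \<Rightarrow>\<^sub>0 'k) set" where
  "special_basis M \<gamma> C =
     monomials M \<union> row_relation \<gamma> (special_matrix C) ` {..<dim_row C}"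


section \<open>Shortest parts of relations\<close>

definition ordered_writing ::
  "('v, 'e) pre_digraph \<Rightarrow> (('v, 'e) path \<Rightarrow>\<^sub>0 'k::field_char_0)
     \<Rightarrow> nat \<Rightarrow> (nat \<Rightarrow> ('v, 'e) path) \<Rightarrow> (nat \<Rightarrow> 'k) \<Rightarrow> bool" where
  "ordered_writing Q \<rho> k \<beta> c \<longleftrightarrow>
     \<beta> ` {..k} \<subseteq> quiver_paths Q \<and> inj_on \<beta> {..k} \<and>
     (\<forall>i\<le>k. c i \<noteq> 0) \<and> c 0 = 1 \<and>
     (\<forall>i j. i \<le> j \<and> j \<le> k \<longrightarrow> path_length (\<beta> j) \<le> path_length (\<beta> i)) \<and>
     \<rho> = Poly_Mapping.single (\<beta> 0) 1 + (\<Sum>i=1..k. Poly_Mapping.single (\<beta> i) (c i))"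

definition constant_length_from :: "nat \<Rightarrow> (nat \<Rightarrow> ('v, 'e) path) \<Rightarrow> nat \<Rightarrow> bool" where
  "constant_length_from k \<beta> k0 \<longleftrightarrow>
     k0 \<le> k \<and> (\<forall>j. k0 \<le> j \<and> j \<le> k \<longrightarrow> path_length (\<beta> j) = path_length (\<beta> k0))"

definition shortest_part ::
  "nat \<Rightarrow> (nat \<Rightarrow> ('v, 'e) path) \<Rightarrow> (nat \<Rightarrow> 'k::field_char_0) \<Rightarrow> ('v, 'e) path \<Rightarrow>\<^sub>0 'k" where
  "shortest_part k \<beta> c =
     (let k0 = (LEAST k0. constant_length_from k \<beta> k0)
      in Poly_Mapping.single (\<beta> k0) 1 +
         (\<Sum>i=k0+1..k. Poly_Mapping.single (\<beta> i) (inverse (c k0) * c i)))"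

end

theory Submission
  imports Defs
begin

text \<open>
  The radical of \<open>A\<close> is the image of the arrow ideal, so its powers are the images of the length
  filtration, and sending a path algebra element to the classes of its homogeneous components
  is an epimorphism onto \<open>gr(A)\<close>.  Its kernel is the ideal of initial forms (lowest-length parts)
  of \<open>I\<close>.  A branch starts at the source and ends at the sink, so \<open>I\<close> is the span of the paths that
  contain a monomial relation plus the linear span of the special relations.  The special matrix
  has its last nonzero entries in pairwise distinct columns; columns are ordered by
  non-increasing length, hence the shortest parts of the special relations are linearly
  independent and span the initial forms of this linear span.
\<close>

section \<open>Scaling and restriction of finitely supported functions\<close>

text \<open>The lowest-length parts of generators need not generate all initial forms of an ideal,
  because lowest parts may cancel in a combination and uncover longer paths. Here cancellation has
  three possible sources. Products with paths produce no new combinations of branches, since a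
  branch cannot be extended on either side. The monomial part cannot interfere, since the branches
  in the matrix contain no monomial relation and so the two summands of \<open>I\<close> have
  disjoint supports. Among the non monomial relations themselves, cancellation is excluded by the
  distinct last columns; the assumption \<open>independent\<close> isolates exactly this point. The
  chosen ordered writings of the relations only affect nonzero scalar factors, so a single ideal
  serves all of them. It is admissible because an element of \<open>I\<close> all of whose paths are
  longer than every path in the special relations already belongs to the monomial part, which both
  ideals share.\<close>

abbreviation scale :: "'k::field_char_0 \<Rightarrow> ('a \<Rightarrow>\<^sub>0 'k) \<Rightarrow> 'a \<Rightarrow>\<^sub>0 'k" where
  "scale c \<equiv> Poly_Mapping.map ((*) c)"

text \<open>A finite sum of \<open>single\<close> terms has finite support by construction. For the
  constantly true predicate it is the expansion of \<open>x\<close> in basis elements.\<close>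

definition restrict_keys :: "('a \<Rightarrow> bool) \<Rightarrow> ('a \<Rightarrow>\<^sub>0 'b::comm_monoid_add) \<Rightarrow> 'a \<Rightarrow>\<^sub>0 'b" where
  "restrict_keys P x = (\<Sum>p\<in>{p \<in> Poly_Mapping.keys x. P p}. Poly_Mapping.single p (Poly_Mapping.lookup x p))"

lemma lookup_scale [simp]:
  "Poly_Mapping.lookup (scale c x) p = c * Poly_Mapping.lookup x p"
  by (simp add: Poly_Mapping.map.rep_eq when_def)

lemma scale_add_right: "scale c (x + y) = scale c x + scale c y"
  by (rule poly_mapping_eqI) (simp add: lookup_add algebra_simps)

lemma scale_add_left: "scale (c + d) x = scale c x + scale d x"
  by (rule poly_mapping_eqI) (simp add: lookup_add algebra_simps)

lemma scale_zero [simp]: "scale c 0 = 0" "scale 0 x = 0"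
  by (rule poly_mapping_eqI; simp)+

lemma scale_one [simp]: "scale 1 x = x"
  by (rule poly_mapping_eqI) simp

lemma scale_scale [simp]: "scale c (scale d x) = scale (c * d) x"
  by (rule poly_mapping_eqI) (simp add: mult.assoc)

lemma scale_minus_one: "scale (-1) x = - x"
  by (rule poly_mapping_eqI) simp

lemma scale_single [simp]: "scale c (Poly_Mapping.single p d) = Poly_Mapping.single p (c * d)"
  by (rule poly_mapping_eqI) (simp add: lookup_single when_def)

lemma scale_sum: "scale c (sum f A) = (\<Sum>a\<in>A. scale c (f a))"
  by (rule poly_mapping_eqI) (simp add: lookup_sum sum_distrib_left)

lemma keys_scale_subset: "Poly_Mapping.keys (scale c x) \<subseteq> Poly_Mapping.keys x"
  by (auto simp: in_keys_iff)

lemma lookup_restrict_keys [simp]: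
  "Poly_Mapping.lookup (restrict_keys P x) p = (if P p then Poly_Mapping.lookup x p else 0)"
proof -
  have "Poly_Mapping.lookup (restrict_keys P x) p =
      (\<Sum>q\<in>{q \<in> Poly_Mapping.keys x. P q}. if q = p then Poly_Mapping.lookup x q else 0)"
    by (simp add: restrict_keys_def lookup_sum lookup_single when_def)
  then show ?thesis
    by (simp add: in_keys_iff)
qed

lemma keys_restrict_keys [simp]:
  "Poly_Mapping.keys (restrict_keys P x) = {p \<in> Poly_Mapping.keys x. P p}"
  by (auto simp: in_keys_iff split: if_splits)

lemma restrict_keys_add: "restrict_keys P (x + y) = restrict_keys P x + restrict_keys P y"
  by (rule poly_mapping_eqI) (simp add: lookup_add)

lemma restrict_keys_zero [simp]: "restrict_keys P 0 = 0"
  by (rule poly_mapping_eqI) simp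

lemma restrict_keys_sum: "restrict_keys P (sum f A) = (\<Sum>a\<in>A. restrict_keys P (f a))"
  by (rule poly_mapping_eqI) (simp add: lookup_sum)

lemma restrict_keys_scale: "restrict_keys P (scale c x) = scale c (restrict_keys P x)"
  by (rule poly_mapping_eqI) simp

lemma restrict_keys_single:
  "restrict_keys P (Poly_Mapping.single p c) = (if P p then Poly_Mapping.single p c else 0)"
  by (rule poly_mapping_eqI) (auto simp: lookup_single when_def)

lemma restrict_keys_id: "(\<And>p. p \<in> Poly_Mapping.keys x \<Longrightarrow> P p) \<Longrightarrow> restrict_keys P x = x"
  by (rule poly_mapping_eqI) (auto simp: in_keys_iff)

lemma sum_single_lookup:
  "(\<Sum>p\<in>Poly_Mapping.keys x. Poly_Mapping.single p (Poly_Mapping.lookup x p)) = x"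
  using restrict_keys_id[of x "\<lambda>_. True"] by (simp add: restrict_keys_def)

text \<open>The step puts no freshness condition on \<open>p\<close>, so additivity alone discharges
  it. This reduces multilinear identities about \<open>pmul\<close> to identities about single
  paths.\<close>

lemma poly_mapping_single_induct [case_names zero add]:
  fixes x :: "'a \<Rightarrow>\<^sub>0 'b::comm_monoid_add"
  assumes "P 0" and "\<And>p c y. P y \<Longrightarrow> P (Poly_Mapping.single p c + y)"
  shows "P x"
proof -
  have "P (\<Sum>p\<in>A. Poly_Mapping.single p (Poly_Mapping.lookup x p))" if "finite A" for A
    using that by induction (simp_all add: assms)
  then show ?thesis
    by (metis finite_keys sum_single_lookup)
qed

lemma keys_sum_subset: "Poly_Mapping.keys (sum f A) \<subseteq> (\<Union>a\<in>A. Poly_Mapping.keys (f a))"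
  by (induction A rule: infinite_finite_induct) (auto dest: subsetD[OF Poly_Mapping.keys_add])

section \<open>The path algebra as a ring\<close>

text \<open>The product in \<open>path_algebra Q\<close> does not mention \<open>Q\<close>; only the
  carrier and the unit do. Naming it separately lets its identities be proved without a
  quiver.\<close>

definition pmul :: "(('v, 'e) path \<Rightarrow>\<^sub>0 'k::field_char_0) \<Rightarrow> (('v, 'e) path \<Rightarrow>\<^sub>0 'k)
    \<Rightarrow> ('v, 'e) path \<Rightarrow>\<^sub>0 'k" where
  "pmul x y = (\<Sum>p\<in>Poly_Mapping.keys x. \<Sum>q\<in>Poly_Mapping.keys y.
                path_mult p q (Poly_Mapping.lookup x p * Poly_Mapping.lookup y q))"

definition pone :: "('v, 'e) pre_digraph \<Rightarrow> ('v, 'e) path \<Rightarrow>\<^sub>0 'k::field_char_0" where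
  "pone Q = (\<Sum>v\<in>verts Q. Poly_Mapping.single (v, [], v) 1)"

definition pcarrier :: "('v, 'e) pre_digraph \<Rightarrow> (('v, 'e) path \<Rightarrow>\<^sub>0 'k::field_char_0) set" where
  "pcarrier Q = {x. Poly_Mapping.keys x \<subseteq> quiver_paths Q}"

lemma path_algebra_simps [simp]:
  "carrier (path_algebra Q) = pcarrier Q"
  "mult (path_algebra Q) = pmul"
  "one (path_algebra Q) = pone Q"
  "zero (path_algebra Q) = 0"
  "add (path_algebra Q) = (+)"
  "module.smult (path_algebra Q) = scale"
  by (simp_all add: path_algebra_def pcarrier_def pmul_def pone_def fun_eq_iff)

lemma path_mult_zero [simp]: "path_mult p q 0 = 0"
  by (simp add: path_mult_def)

lemma path_mult_add: "path_mult p q (c + d) = path_mult p q c + path_mult p q d"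
  by (simp add: path_mult_def single_add)

text \<open>The keys of \<open>x + y\<close> differ from those of \<open>x\<close> and
  \<open>y\<close>. Over a common finite index set the defining sums can be compared term by term,
  the added terms having coefficient 0.\<close>

lemma pmul_superset:
  assumes "finite A" "finite B" "Poly_Mapping.keys x \<subseteq> A" "Poly_Mapping.keys y \<subseteq> B"
  shows "pmul x y = (\<Sum>p\<in>A. \<Sum>q\<in>B. path_mult p q (Poly_Mapping.lookup x p * Poly_Mapping.lookup y q))"
proof -
  have "(\<Sum>q\<in>Poly_Mapping.keys y. path_mult p q (Poly_Mapping.lookup x p * Poly_Mapping.lookup y q)) =
      (\<Sum>q\<in>B. path_mult p q (Poly_Mapping.lookup x p * Poly_Mapping.lookup y q))" for p
    using assms by (intro sum.mono_neutral_left) (auto simp: in_keys_iff)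
  moreover have "(\<Sum>p\<in>Poly_Mapping.keys x. \<Sum>q\<in>B. path_mult p q (Poly_Mapping.lookup x p * Poly_Mapping.lookup y q)) =
      (\<Sum>p\<in>A. \<Sum>q\<in>B. path_mult p q (Poly_Mapping.lookup x p * Poly_Mapping.lookup y q))"
    using assms by (intro sum.mono_neutral_left) (auto simp: in_keys_iff)
  ultimately show ?thesis by (simp add: pmul_def)
qed

lemma pmul_add_left: "pmul (x + y) z = pmul x z + pmul y z"
proof -
  let ?A = "Poly_Mapping.keys x \<union> Poly_Mapping.keys y" and ?B = "Poly_Mapping.keys z"
  have "Poly_Mapping.keys (x + y) \<subseteq> ?A" by (rule Poly_Mapping.keys_add)
  then show ?thesis
    by (simp add: pmul_superset[of ?A ?B] lookup_add distrib_right path_mult_add sum.distrib)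
qed

lemma pmul_add_right: "pmul x (y + z) = pmul x y + pmul x z"
proof -
  let ?B = "Poly_Mapping.keys y \<union> Poly_Mapping.keys z" and ?A = "Poly_Mapping.keys x"
  have "Poly_Mapping.keys (y + z) \<subseteq> ?B" by (rule Poly_Mapping.keys_add)
  then show ?thesis
    by (simp add: pmul_superset[of ?A ?B] lookup_add distrib_left path_mult_add sum.distrib)
qed

lemma pmul_zero [simp]: "pmul 0 x = 0" "pmul x 0 = 0"
  by (simp_all add: pmul_def)

lemma pmul_sum_left: "pmul (sum f A) y = (\<Sum>a\<in>A. pmul (f a) y)"
  by (induction A rule: infinite_finite_induct) (simp_all add: pmul_add_left)

lemma pmul_sum_right: "pmul y (sum f A) = (\<Sum>a\<in>A. pmul y (f a))"
  by (induction A rule: infinite_finite_induct) (simp_all add: pmul_add_right)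

lemma pmul_single [simp]:
  "pmul (Poly_Mapping.single p c) (Poly_Mapping.single q d) = path_mult p q (c * d)"
  by (simp add: pmul_superset[of "{p}" "{q}"])

text \<open>For three single paths both sides are the full concatenation if both junctions fit, and
  0 otherwise; the nested inductions reduce to this case.\<close>

lemma pmul_assoc: "pmul (pmul x y) z = pmul x (pmul y z)"
proof (induction x rule: poly_mapping_single_induct)
  case (add p a x)
  have "pmul (pmul (Poly_Mapping.single p a) y) z = pmul (Poly_Mapping.single p a) (pmul y z)"
  proof (induction y rule: poly_mapping_single_induct)
    case (add q b y)
    have "pmul (path_mult p q (a * b)) z = pmul (Poly_Mapping.single p a) (pmul (Poly_Mapping.single q b) z)"
    proof (induction z rule: poly_mapping_single_induct)
      case (add s c z)
      have "pmul (path_mult p q (a * b)) (Poly_Mapping.single s c) =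
          pmul (Poly_Mapping.single p a) (path_mult q s (b * c))"
        by (auto simp: path_mult_def mult.assoc)
      then show ?case by (simp add: add pmul_add_left pmul_add_right)
    qed simp
    then show ?case by (simp add: add pmul_add_left pmul_add_right)
  qed simp
  then show ?case by (simp add: add pmul_add_left)
qed simp

lemma keys_pmul:
  assumes "r \<in> Poly_Mapping.keys (pmul x y)"
  obtains p q where "p \<in> Poly_Mapping.keys x" "q \<in> Poly_Mapping.keys y" "snd (snd p) = fst q"
    "r = (fst p, fst (snd p) @ fst (snd q), snd (snd q))"
proof -
  have "Poly_Mapping.keys (pmul x y) \<subseteq> (\<Union>p\<in>Poly_Mapping.keys x. \<Union>q\<in>Poly_Mapping.keys y.
      Poly_Mapping.keys (path_mult p q (Poly_Mapping.lookup x p * Poly_Mapping.lookup y q)))"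
    unfolding pmul_def
    by (rule subset_trans[OF keys_sum_subset UN_mono[OF order_refl keys_sum_subset]])
  then obtain p q where "p \<in> Poly_Mapping.keys x" "q \<in> Poly_Mapping.keys y"
    "r \<in> Poly_Mapping.keys (path_mult p q (Poly_Mapping.lookup x p * Poly_Mapping.lookup y q))"
    using assms by blast
  then show ?thesis
    by (intro that[of p q]) (simp_all add: path_mult_def split: if_splits)
qed

lemma pmul_scale_left: "pmul (scale c x) y = scale c (pmul x y)"
proof (induction x rule: poly_mapping_single_induct)
  case (add p a x)
  have "pmul (Poly_Mapping.single p (c * a)) y = scale c (pmul (Poly_Mapping.single p a) y)"
  proof (induction y rule: poly_mapping_single_induct)
    case (add q b y)
    then show ?case
      by (simp add: pmul_add_right scale_add_right path_mult_def mult.assoc)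
  qed simp
  then show ?case by (simp add: add pmul_add_left scale_add_right)
qed simp

lemma pmul_scale_right: "pmul x (scale c y) = scale c (pmul x y)"
proof (induction y rule: poly_mapping_single_induct)
  case (add q b y)
  have "pmul x (Poly_Mapping.single q (c * b)) = scale c (pmul x (Poly_Mapping.single q b))"
  proof (induction x rule: poly_mapping_single_induct)
    case (add p a x)
    then show ?case
      by (simp add: pmul_add_left scale_add_right path_mult_def mult.left_commute)
  qed simp
  then show ?case by (simp add: add pmul_add_right scale_add_right)
qed simp

lemma pcarrier_zero [simp]: "0 \<in> pcarrier Q"
  by (simp add: pcarrier_def)

lemma pcarrier_add: "x \<in> pcarrier Q \<Longrightarrow> y \<in> pcarrier Q \<Longrightarrow> x + y \<in> pcarrier Q"
  unfolding pcarrier_def using Poly_Mapping.keys_add[of x y] by auto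

lemma pcarrier_uminus: "x \<in> pcarrier Q \<Longrightarrow> - x \<in> pcarrier Q"
  by (auto simp: pcarrier_def in_keys_iff subset_iff)

lemma pcarrier_scale: "x \<in> pcarrier Q \<Longrightarrow> scale c x \<in> pcarrier Q"
  by (auto simp: pcarrier_def in_keys_iff subset_iff)

lemma pcarrier_diff: "x \<in> pcarrier Q \<Longrightarrow> y \<in> pcarrier Q \<Longrightarrow> x - y \<in> pcarrier Q"
  using pcarrier_add[of x Q "- y"] pcarrier_uminus[of y Q] by simp

lemma pcarrier_single: "p \<in> quiver_paths Q \<Longrightarrow> Poly_Mapping.single p c \<in> pcarrier Q"
  by (simp add: pcarrier_def)

lemma pcarrier_sum: "(\<And>a. a \<in> A \<Longrightarrow> f a \<in> pcarrier Q) \<Longrightarrow> sum f A \<in> pcarrier Q"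
  by (induction A rule: infinite_finite_induct) (auto simp: pcarrier_add)

lemma pcarrier_restrict_keys: "x \<in> pcarrier Q \<Longrightarrow> restrict_keys P x \<in> pcarrier Q"
  by (auto simp: pcarrier_def)

context wf_digraph
begin

lemma quiver_paths_append:
  assumes "(u, p, w) \<in> quiver_paths G" "(w, q, v) \<in> quiver_paths G"
  shows "(u, p @ q, v) \<in> quiver_paths G"
  using assms by (auto simp: quiver_paths_def)

lemma quiver_paths_verts:
  "(u, p, v) \<in> quiver_paths G \<Longrightarrow> u \<in> verts G \<and> v \<in> verts G"
  by (auto simp: quiver_paths_def)

lemma quiver_paths_appendE:
  assumes "(u, p @ q, v) \<in> quiver_paths G"
  obtains w where "(u, p, w) \<in> quiver_paths G" "(w, q, v) \<in> quiver_paths G"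
  using assms by (auto simp: quiver_paths_def)

text \<open>A nonempty arrow list determines its ends by its first and last arrows, whereas the
  empty list is a walk at every vertex.\<close>

lemma quiver_paths_ends_unique:
  assumes "(u, p, v) \<in> quiver_paths G" "(u', p, v') \<in> quiver_paths G" "p \<noteq> []"
  shows "u = u' \<and> v = v'"
  using assms awalk_ends[of u p v u' v'] by (simp add: quiver_paths_def)

lemma pcarrier_pmul:
  assumes "x \<in> pcarrier G" "y \<in> pcarrier G"
  shows "pmul x y \<in> pcarrier G"
  unfolding pcarrier_def
proof safe
  fix a b c assume "(a, b, c) \<in> Poly_Mapping.keys (pmul x y)"
  then show "(a, b, c) \<in> quiver_paths G"
    using assms by (elim keys_pmul) (auto simp: pcarrier_def intro!: quiver_paths_append)
qed

lemma pcarrier_pone: "pone G \<in> pcarrier G"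
  unfolding pone_def by (intro pcarrier_sum pcarrier_single) (simp add: quiver_paths_def awalk_Nil_iff)

end

context fin_digraph
begin

text \<open>Only the trivial path at the start of \<open>p\<close> composes with \<open>p\<close>.
  The sum picks out this term because the vertex set is finite.\<close>

lemma pmul_pone_left:
  assumes "x \<in> pcarrier G"
  shows "pmul (pone G) x = x"
proof -
  have "pmul (pone G) (Poly_Mapping.single p c) = Poly_Mapping.single p c"
    if "p \<in> quiver_paths G" for p :: "('a, 'b) path" and c :: 'c
  proof (cases p)
    case (fields u es v)
    then have "u \<in> verts G" using quiver_paths_verts that by blast
    have "pmul (pone G) (Poly_Mapping.single p c) =
        (\<Sum>w\<in>verts G. if w = u then Poly_Mapping.single p c else 0)"
      unfolding pone_def pmul_sum_left using fields
      by (intro sum.cong) (auto simp: path_mult_def)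
    then show ?thesis using \<open>u \<in> verts G\<close> by simp
  qed
  then have "(\<Sum>p\<in>Poly_Mapping.keys x. pmul (pone G) (Poly_Mapping.single p (Poly_Mapping.lookup x p)))
      = (\<Sum>p\<in>Poly_Mapping.keys x. Poly_Mapping.single p (Poly_Mapping.lookup x p))"
    using assms by (intro sum.cong) (auto simp: pcarrier_def)
  then show ?thesis by (simp add: pmul_sum_right[symmetric] sum_single_lookup)
qed

lemma pmul_pone_right:
  assumes "x \<in> pcarrier G"
  shows "pmul x (pone G) = x"
proof -
  have "pmul (Poly_Mapping.single p c) (pone G) = Poly_Mapping.single p c"
    if "p \<in> quiver_paths G" for p :: "('a, 'b) path" and c :: 'c
  proof (cases p)
    case (fields u es v)
    then have "v \<in> verts G" using quiver_paths_verts that by blast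
    have "pmul (Poly_Mapping.single p c) (pone G) =
        (\<Sum>w\<in>verts G. if w = v then Poly_Mapping.single p c else 0)"
      unfolding pone_def pmul_sum_right using fields
      by (intro sum.cong) (auto simp: path_mult_def)
    then show ?thesis using \<open>v \<in> verts G\<close> by simp
  qed
  then have "(\<Sum>p\<in>Poly_Mapping.keys x. pmul (Poly_Mapping.single p (Poly_Mapping.lookup x p)) (pone G))
      = (\<Sum>p\<in>Poly_Mapping.keys x. Poly_Mapping.single p (Poly_Mapping.lookup x p))"
    using assms by (intro sum.cong) (auto simp: pcarrier_def)
  then show ?thesis by (simp add: pmul_sum_left[symmetric] sum_single_lookup)
qed

lemma ring_path_algebra: "ring (path_algebra G :: ('k::field_char_0, ('a, 'b) path \<Rightarrow>\<^sub>0 'k) module)"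
proof (rule ringI)
  show "abelian_group (path_algebra G :: ('k::field_char_0, ('a, 'b) path \<Rightarrow>\<^sub>0 'k) module)"
  proof (rule abelian_groupI)
    fix x :: "('a, 'b) path \<Rightarrow>\<^sub>0 'k"
    assume "x \<in> carrier (path_algebra G)"
    then show "\<exists>y\<in>carrier (path_algebra G). y \<oplus>\<^bsub>path_algebra G\<^esub> x = \<zero>\<^bsub>path_algebra G\<^esub>"
      by (intro bexI[of _ "- x"]) (simp_all add: pcarrier_uminus)
  qed (simp_all add: pcarrier_add algebra_simps)
  show "Group.monoid (path_algebra G :: ('k::field_char_0, ('a, 'b) path \<Rightarrow>\<^sub>0 'k) module)"
    by (rule monoidI) (simp_all add: pcarrier_pmul pcarrier_pone pmul_assoc pmul_pone_left pmul_pone_right)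
qed (simp_all add: pmul_add_left pmul_add_right)

lemma a_inv_path_algebra [simp]:
  "(x :: ('a, 'b) path \<Rightarrow>\<^sub>0 'k::field_char_0) \<in> pcarrier G \<Longrightarrow> \<ominus>\<^bsub>path_algebra G\<^esub> x = - x"
  using abelian_group.minus_equality[OF ring.is_abelian_group[OF ring_path_algebra], of "- x" x]
  by (simp add: pcarrier_uminus)

lemma a_minus_path_algebra [simp]:
  "(y :: ('a, 'b) path \<Rightarrow>\<^sub>0 'k::field_char_0) \<in> pcarrier G \<Longrightarrow> x \<ominus>\<^bsub>path_algebra G\<^esub> y = x - y"
  by (simp add: a_minus_def)

end

section \<open>The length filtration\<close>

text \<open>This is the \<open>t\<close>-th power of the arrow ideal
  (\<open>ideal_power_pfilt\<close>), given by a condition on supports instead of the inductive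
  \<open>ideal_prod\<close>.\<close>

definition pfilt :: "('v, 'e) pre_digraph \<Rightarrow> nat \<Rightarrow> (('v, 'e) path \<Rightarrow>\<^sub>0 'k::field_char_0) set" where
  "pfilt Q t = {x \<in> pcarrier Q. \<forall>p\<in>Poly_Mapping.keys x. t \<le> path_length p}"

definition homog :: "nat \<Rightarrow> (('v, 'e) path \<Rightarrow>\<^sub>0 'k::field_char_0) \<Rightarrow> ('v, 'e) path \<Rightarrow>\<^sub>0 'k" where
  "homog t = restrict_keys (\<lambda>p. path_length p = t)"

lemma lookup_homog [simp]:
  "Poly_Mapping.lookup (homog t x) p = (if path_length p = t then Poly_Mapping.lookup x p else 0)"
  by (simp add: homog_def)

lemma homog_zero [simp]: "homog t 0 = 0"
  by (simp add: homog_def)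

lemma homog_add: "homog t (x + y) = homog t x + homog t y"
  by (simp add: homog_def restrict_keys_add)

lemma homog_sum: "homog t (sum f A) = (\<Sum>a\<in>A. homog t (f a))"
  by (simp add: homog_def restrict_keys_sum)

lemma homog_scale: "homog t (scale c x) = scale c (homog t x)"
  by (simp add: homog_def restrict_keys_scale)

lemma homog_single:
  "homog t (Poly_Mapping.single p c) = (if path_length p = t then Poly_Mapping.single p c else 0)"
  by (simp add: homog_def restrict_keys_single)

lemma pfilt_0 [simp]: "pfilt Q 0 = pcarrier Q"
  by (simp add: pfilt_def)

lemma pfilt_antimono: "s \<le> t \<Longrightarrow> pfilt Q t \<subseteq> pfilt Q s"
  by (auto simp: pfilt_def intro: order_trans)

lemma pfilt_subset: "pfilt Q t \<subseteq> pcarrier Q"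
  by (auto simp: pfilt_def)

lemma pfilt_zero [simp]: "0 \<in> pfilt Q t"
  by (simp add: pfilt_def)

lemma pfilt_add: "x \<in> pfilt Q t \<Longrightarrow> y \<in> pfilt Q t \<Longrightarrow> x + y \<in> pfilt Q t"
  unfolding pfilt_def using Poly_Mapping.keys_add[of x y] by (auto simp: pcarrier_add)

lemma pfilt_scale: "x \<in> pfilt Q t \<Longrightarrow> scale c x \<in> pfilt Q t"
  unfolding pfilt_def using keys_scale_subset[of c x] by (auto simp: pcarrier_scale)

lemma pfilt_sum: "(\<And>a. a \<in> A \<Longrightarrow> f a \<in> pfilt Q t) \<Longrightarrow> sum f A \<in> pfilt Q t"
  by (induction A rule: infinite_finite_induct) (auto simp: pfilt_add)

lemma pfilt_single:
  "p \<in> quiver_paths Q \<Longrightarrow> t \<le> path_length p \<Longrightarrow> Poly_Mapping.single p c \<in> pfilt Q t"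
  by (simp add: pfilt_def pcarrier_single)

lemma homog_in_pfilt: "x \<in> pcarrier Q \<Longrightarrow> homog t x \<in> pfilt Q t"
  by (auto simp: pfilt_def homog_def pcarrier_restrict_keys)

lemma pfilt_Suc_diff_homog: "x \<in> pfilt Q t \<Longrightarrow> x - homog t x \<in> pfilt Q (Suc t)"
  by (auto simp: pfilt_def homog_def pcarrier_diff pcarrier_restrict_keys in_keys_iff lookup_minus
      Suc_le_eq order_less_le split: if_splits)

lemma homog_pfilt:
  assumes "x \<in> pfilt Q s" "t < s"
  shows "homog t x = 0"
proof (rule poly_mapping_eqI)
  fix p
  have "p \<notin> Poly_Mapping.keys x" if "path_length p = t"
    using that assms by (auto simp: pfilt_def)
  then show "Poly_Mapping.lookup (homog t x) p = Poly_Mapping.lookup 0 p"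
    by (simp add: in_keys_iff)
qed

lemma (in wf_digraph) pfilt_pmul:
  assumes "x \<in> pfilt G s" "y \<in> pfilt G t"
  shows "pmul x y \<in> pfilt G (s + t)"
proof -
  have "s + t \<le> path_length r" if r: "r \<in> Poly_Mapping.keys (pmul x y)" for r
  proof -
    obtain p q where "p \<in> Poly_Mapping.keys x" "q \<in> Poly_Mapping.keys y"
      "r = (fst p, fst (snd p) @ fst (snd q), snd (snd q))"
      using keys_pmul[OF r] by blast
    then show ?thesis
      using assms by (fastforce simp: pfilt_def path_length_def intro: add_mono)
  qed
  then show ?thesis
    using assms by (auto simp: pfilt_def pcarrier_pmul)
qed

text \<open>Lengths add under concatenation, so the path algebra is graded by length. The shape of
  the sum matches the multiplication of \<open>associated_graded\<close>.\<close>

lemma homog_pmul: "homog t (pmul x y) = (\<Sum>i\<le>t. pmul (homog i x) (homog (t - i) y))"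
proof (induction x rule: poly_mapping_single_induct)
  case (add p c x)
  have "homog t (pmul (Poly_Mapping.single p c) y) =
      (\<Sum>i\<le>t. pmul (homog i (Poly_Mapping.single p c)) (homog (t - i) y))"
  proof (induction y rule: poly_mapping_single_induct)
    case (add q d y)
    have "(\<Sum>i\<le>t. pmul (homog i (Poly_Mapping.single p c)) (homog (t - i) (Poly_Mapping.single q d))) =
        (\<Sum>i\<le>t. if i = path_length p then
           (if path_length q = t - path_length p then path_mult p q (c * d) else 0) else 0)"
      by (intro sum.cong) (auto simp: homog_single)
    also have "\<dots> = homog t (path_mult p q (c * d))"
      by (auto simp: path_mult_def homog_single path_length_def)
    finally show ?case
      using add by (simp add: homog_add pmul_add_right sum.distrib)
  qed simp
  then show ?case
    using add by (simp add: homog_add pmul_add_left sum.distrib)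
qed simp

lemma sum_homog:
  assumes "\<And>p. p \<in> Poly_Mapping.keys x \<Longrightarrow> path_length p < N"
  shows "(\<Sum>t<N. homog t x) = x"
proof (rule poly_mapping_eqI)
  fix p
  show "Poly_Mapping.lookup (\<Sum>t<N. homog t x) p = Poly_Mapping.lookup x p"
    using assms[of p] by (auto simp: lookup_sum in_keys_iff)
qed

section \<open>Ideals of the path algebra\<close>

context fin_digraph
begin

text \<open>Scalars act through multiples of the unit. Hence ring ideals are subspaces, and closure
  under negatives follows from closure under multiplication.\<close>

lemma pmul_scale_pone: "x \<in> pcarrier G \<Longrightarrow> pmul (scale c (pone G)) x = scale c x"
  by (simp add: pmul_scale_left pmul_pone_left)

lemma ideal_path_algebraI:
  fixes J :: "(('a, 'b) path \<Rightarrow>\<^sub>0 'k::field_char_0) set"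
  assumes "J \<subseteq> pcarrier G" "0 \<in> J" "\<And>x y. x \<in> J \<Longrightarrow> y \<in> J \<Longrightarrow> x + y \<in> J"
    "\<And>x y. x \<in> pcarrier G \<Longrightarrow> y \<in> J \<Longrightarrow> pmul x y \<in> J"
    "\<And>x y. x \<in> J \<Longrightarrow> y \<in> pcarrier G \<Longrightarrow> pmul x y \<in> J"
  shows "ideal J (path_algebra G)"
proof (rule idealI)
  show "ring (path_algebra G :: ('k, ('a, 'b) path \<Rightarrow>\<^sub>0 'k) module)" by (rule ring_path_algebra)
  then interpret ring "path_algebra G :: ('k, ('a, 'b) path \<Rightarrow>\<^sub>0 'k) module" .
  have minus: "- x \<in> J" if "x \<in> J" for x
  proof -
    have "x \<in> pcarrier G" using assms(1) that by blast
    then have "- x = pmul (scale (-1) (pone G)) x"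
      by (subst pmul_scale_pone) (simp_all only: scale_minus_one)
    also have "\<dots> \<in> J"
      using that by (intro assms(4) pcarrier_scale pcarrier_pone)
    finally show ?thesis .
  qed
  show "subgroup J (add_monoid (path_algebra G))"
  proof (rule add.subgroupI)
    show "\<And>x. x \<in> J \<Longrightarrow> \<ominus>\<^bsub>path_algebra G\<^esub> x \<in> J"
      using minus assms(1) by auto
  qed (use assms in auto)
qed (use assms in auto)

context
  fixes J :: "(('a, 'b) path \<Rightarrow>\<^sub>0 'k::field_char_0) set"
  assumes J: "ideal J (path_algebra G)"
begin

interpretation ideal J "path_algebra G" by (rule J)

lemma ideal_subset_pcarrier: "J \<subseteq> pcarrier G"
  using a_subset by simp

lemma ideal_zero: "0 \<in> J"
  using additive_subgroup.zero_closed[OF is_additive_subgroup] by simp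

lemma ideal_add: "x \<in> J \<Longrightarrow> y \<in> J \<Longrightarrow> x + y \<in> J"
  using additive_subgroup.a_closed[OF is_additive_subgroup, of x y] by simp

lemma ideal_pmul_left: "x \<in> pcarrier G \<Longrightarrow> y \<in> J \<Longrightarrow> pmul x y \<in> J"
  using I_l_closed[of y x] by simp

lemma ideal_pmul_right: "x \<in> J \<Longrightarrow> y \<in> pcarrier G \<Longrightarrow> pmul x y \<in> J"
  using I_r_closed[of x y] by simp

lemma ideal_scale:
  assumes "x \<in> J"
  shows "scale c x \<in> J"
proof -
  have "x \<in> pcarrier G"
    using assms ideal_subset_pcarrier by blast
  then have "scale c x = pmul (scale c (pone G)) x"
    by (simp only: pmul_scale_pone)
  also have "\<dots> \<in> J"
    using assms by (intro ideal_pmul_left pcarrier_scale pcarrier_pone)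
  finally show ?thesis .
qed

lemma ideal_uminus: "x \<in> J \<Longrightarrow> - x \<in> J"
  using ideal_scale[of x "-1"] by (simp only: scale_minus_one)

lemma ideal_diff: "x \<in> J \<Longrightarrow> y \<in> J \<Longrightarrow> x - y \<in> J"
  using ideal_add[of x "- y"] ideal_uminus[of y] by simp

lemma ideal_sum: "(\<And>a. a \<in> A \<Longrightarrow> f a \<in> J) \<Longrightarrow> sum f A \<in> J"
  by (induction A rule: infinite_finite_induct) (auto simp: ideal_zero ideal_add)

end

lemma ideal_pfilt: "ideal (pfilt G t :: (('a, 'b) path \<Rightarrow>\<^sub>0 'k::field_char_0) set) (path_algebra G)"
proof (rule ideal_path_algebraI)
  fix x y :: "('a, 'b) path \<Rightarrow>\<^sub>0 'k"
  show "pmul x y \<in> pfilt G t" if "x \<in> pcarrier G" "y \<in> pfilt G t"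
    using pfilt_pmul[of x 0 y t] that by simp
  show "pmul x y \<in> pfilt G t" if "x \<in> pfilt G t" "y \<in> pcarrier G"
    using pfilt_pmul[of x t y 0] that by simp
qed (auto simp: pfilt_subset pfilt_add)

lemma genideal_is_ideal:
  fixes S :: "(('a, 'b) path \<Rightarrow>\<^sub>0 'k::field_char_0) set"
  shows "S \<subseteq> pcarrier G \<Longrightarrow> ideal (Idl\<^bsub>path_algebra G\<^esub> S) (path_algebra G)"
  using ring.genideal_ideal[OF ring_path_algebra, of S] by simp

lemma genideal_superset: "S \<subseteq> Idl\<^bsub>path_algebra G\<^esub> S"
  by (auto simp: genideal_def)

lemma genideal_least: "ideal J (path_algebra G) \<Longrightarrow> S \<subseteq> J \<Longrightarrow> Idl\<^bsub>path_algebra G\<^esub> S \<subseteq> J"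
  by (auto simp: genideal_def)

lemma genideal_eqI:
  fixes S T :: "(('a, 'b) path \<Rightarrow>\<^sub>0 'k::field_char_0) set"
  assumes "S \<subseteq> pcarrier G" "T \<subseteq> pcarrier G"
    "S \<subseteq> Idl\<^bsub>path_algebra G\<^esub> T" "T \<subseteq> Idl\<^bsub>path_algebra G\<^esub> S"
  shows "Idl\<^bsub>path_algebra G\<^esub> S = Idl\<^bsub>path_algebra G\<^esub> T"
  using assms by (intro antisym genideal_least genideal_is_ideal)

text \<open>Absorbs the normalising factor of \<open>shortest_part\<close>, which depends on the
  chosen writing of the relation.\<close>

lemma genideal_scale:
  fixes g :: "'c \<Rightarrow> ('a, 'b) path \<Rightarrow>\<^sub>0 'k::field_char_0"
  assumes "g ` S \<subseteq> pcarrier G" "\<And>s. s \<in> S \<Longrightarrow> f s \<noteq> 0"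
  shows "Idl\<^bsub>path_algebra G\<^esub> ((\<lambda>s. scale (f s) (g s)) ` S) = Idl\<^bsub>path_algebra G\<^esub> (g ` S)"
    (is "Idl\<^bsub>_\<^esub> ?T = _")
proof (rule genideal_eqI)
  show T: "?T \<subseteq> pcarrier G"
    using assms by (auto simp: pcarrier_scale)
  show "?T \<subseteq> Idl\<^bsub>path_algebra G\<^esub> (g ` S)"
    using genideal_superset[of "g ` S"] ideal_scale[OF genideal_is_ideal[OF assms(1)]] by blast
  show "g ` S \<subseteq> Idl\<^bsub>path_algebra G\<^esub> ?T"
  proof safe
    fix s assume s: "s \<in> S"
    then have "scale (f s) (g s) \<in> Idl\<^bsub>path_algebra G\<^esub> ?T"
      using genideal_superset[of ?T] by blast
    from ideal_scale[OF genideal_is_ideal[OF T] this, of "inverse (f s)"]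
    show "g s \<in> Idl\<^bsub>path_algebra G\<^esub> ?T"
      using assms(2)[OF s] by simp
  qed
qed (rule assms)

lemma path_Cons_cases:
  assumes "p \<in> quiver_paths G" "0 < path_length p"
  obtains e es where "e \<in> arcs G" "p = (tail G e, e # es, snd (snd p))"
    "(tail G e, [e], head G e) \<in> quiver_paths G" "(head G e, es, snd (snd p)) \<in> quiver_paths G"
proof (cases p)
  case (fields u l v)
  with assms obtain e es where l: "l = e # es" by (cases l) (auto simp: path_length_def)
  show ?thesis
    by (rule that[of e es]) (use assms fields l in \<open>auto simp: quiver_paths_def awalk_simps\<close>)
qed

text \<open>Splitting off the first arrow exhibits each path of positive length as a multiple of a
  generator; linear combinations follow.\<close>

lemma arrow_ideal_eq:
  "(arrow_ideal G :: (('a, 'b) path \<Rightarrow>\<^sub>0 'k::field_char_0) set) = pfilt G 1"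
proof
  let ?A = "(\<lambda>e. Poly_Mapping.single (tail G e, [e], head G e) (1 :: 'k)) ` arcs G"
  have arrow: "(tail G e, [e], head G e) \<in> quiver_paths G" if "e \<in> arcs G" for e
    using that by (auto simp: quiver_paths_def arc_implies_awalk)
  show "arrow_ideal G \<subseteq> (pfilt G 1 :: (('a, 'b) path \<Rightarrow>\<^sub>0 'k) set)"
    unfolding arrow_ideal_def
    by (rule genideal_least[OF ideal_pfilt]) (auto simp: path_length_def intro!: pfilt_single arrow)
  have "?A \<subseteq> pcarrier G"
    using arrow by (auto simp: pcarrier_single)
  note J = genideal_is_ideal[OF this]
  show "(pfilt G 1 :: (('a, 'b) path \<Rightarrow>\<^sub>0 'k) set) \<subseteq> arrow_ideal G"
  proof
    fix x :: "('a, 'b) path \<Rightarrow>\<^sub>0 'k" assume x: "x \<in> pfilt G 1"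
    have "Poly_Mapping.single p c \<in> Idl\<^bsub>path_algebra G\<^esub> ?A"
      if "p \<in> Poly_Mapping.keys x" for p c
    proof -
      have "p \<in> quiver_paths G" "0 < path_length p"
        using that x by (auto simp: pfilt_def pcarrier_def)
      then obtain e es where e: "e \<in> arcs G" "p = (tail G e, e # es, snd (snd p))"
        "(tail G e, [e], head G e) \<in> quiver_paths G" "(head G e, es, snd (snd p)) \<in> quiver_paths G"
        by (rule path_Cons_cases)
      have "pmul (Poly_Mapping.single (tail G e, [e], head G e) 1)
          (Poly_Mapping.single (head G e, es, snd (snd p)) c) \<in> Idl\<^bsub>path_algebra G\<^esub> ?A"
        using e genideal_superset[of ?A] by (intro ideal_pmul_right[OF J]) (auto simp: pcarrier_single)
      then show ?thesis using e by (simp add: path_mult_def)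
    qed
    then have "(\<Sum>p\<in>Poly_Mapping.keys x. Poly_Mapping.single p (Poly_Mapping.lookup x p))
        \<in> Idl\<^bsub>path_algebra G\<^esub> ?A"
      by (intro ideal_sum[OF J])
    then show "x \<in> arrow_ideal G"
      by (simp add: sum_single_lookup arrow_ideal_def)
  qed
qed

text \<open>A path of length at least \<open>Suc t\<close> is its first arrow times a path of length
  at least \<open>t\<close>; in the other direction lengths add.\<close>

lemma ideal_power_pfilt:
  "ideal_power (path_algebra G) (pfilt G 1 :: (('a, 'b) path \<Rightarrow>\<^sub>0 'k::field_char_0) set) t = pfilt G t"
proof (induction t)
  case (Suc t)
  let ?J = "ideal_prod (path_algebra G) (pfilt G 1) (pfilt G t :: (('a, 'b) path \<Rightarrow>\<^sub>0 'k) set)"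
  interpret ring "path_algebra G :: ('k, ('a, 'b) path \<Rightarrow>\<^sub>0 'k) module" by (rule ring_path_algebra)
  have J: "ideal ?J (path_algebra G)"
    by (intro ideal_prod_is_ideal ideal_pfilt)
  have "?J \<subseteq> pfilt G (Suc t)"
  proof
    fix x assume "x \<in> ?J"
    then show "x \<in> pfilt G (Suc t)"
    proof induction
      case (prod i j)
      then show ?case using pfilt_pmul[of i 1 j t] by simp
    qed (simp add: pfilt_add)
  qed
  moreover have "pfilt G (Suc t) \<subseteq> ?J"
  proof
    fix x :: "('a, 'b) path \<Rightarrow>\<^sub>0 'k" assume x: "x \<in> pfilt G (Suc t)"
    have "Poly_Mapping.single p c \<in> ?J" if "p \<in> Poly_Mapping.keys x" for p c
    proof -
      have p: "p \<in> quiver_paths G" "Suc t \<le> path_length p"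
        using that x by (auto simp: pfilt_def pcarrier_def)
      then have "0 < path_length p" by simp
      from p(1) this obtain e es where e: "e \<in> arcs G" "p = (tail G e, e # es, snd (snd p))"
        "(tail G e, [e], head G e) \<in> quiver_paths G" "(head G e, es, snd (snd p)) \<in> quiver_paths G"
        by (rule path_Cons_cases)
      then have "path_length p = Suc (length es)" by (metis fst_conv length_Cons path_length_def snd_conv)
      with p e have "Poly_Mapping.single (tail G e, [e], head G e) 1 \<otimes>\<^bsub>path_algebra G\<^esub>
          Poly_Mapping.single (head G e, es, snd (snd p)) c \<in> ?J"
        by (intro ideal_prod.prod pfilt_single) (auto simp: path_length_def)
      then show ?thesis using e by (simp add: path_mult_def)
    qed
    then have "(\<Sum>p\<in>Poly_Mapping.keys x. Poly_Mapping.single p (Poly_Mapping.lookup x p)) \<in> ?J"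
      by (intro ideal_sum[OF J])
    then show "x \<in> ?J" by (simp add: sum_single_lookup)
  qed
  ultimately show ?case using Suc by simp
qed simp

text \<open>From here on admissibility is used only in this form, as a statement about path
  lengths.\<close>

lemma admissible_ideal_iff:
  "admissible_ideal G (I :: (('a, 'b) path \<Rightarrow>\<^sub>0 'k::field_char_0) set) \<longleftrightarrow>
     ideal I (path_algebra G) \<and> I \<subseteq> pfilt G 2 \<and> (\<exists>N\<ge>2. pfilt G N \<subseteq> I)"
  by (simp add: admissible_ideal_def arrow_ideal_eq ideal_power_pfilt del: One_nat_def)

end

section \<open>Ideals generated by paths and by combinations of branches\<close>

text \<open>For \<open>M\<close> of paths of positive length this is the ideal generated by
  \<open>M\<close>; the description by supports lets membership be tested path by path.\<close>

definition monomial_span ::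
  "('v, 'e) pre_digraph \<Rightarrow> ('v, 'e) path set \<Rightarrow> (('v, 'e) path \<Rightarrow>\<^sub>0 'k::field_char_0) set" where
  "monomial_span Q M = {x \<in> pcarrier Q. \<forall>p\<in>Poly_Mapping.keys x. contains_monomial M p}"

context fin_digraph
begin

text \<open>No arrow enters \<open>v0\<close> and none leaves \<omega>, so only a trivial path
  composes with a branch on either side. Hence every subspace spanned by combinations of branches is
  a two-sided ideal.\<close>

lemma pmul_branches:
  fixes x v :: "('a, 'b) path \<Rightarrow>\<^sub>0 'k::field_char_0"
  assumes "in_arcs G v0 = {}" "out_arcs G \<omega> = {}"
    and v: "Poly_Mapping.keys v \<subseteq> branches G v0 \<omega>" and x: "x \<in> pcarrier G"
  shows "pmul x v = scale (Poly_Mapping.lookup x (v0, [], v0)) v"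
    and "pmul v x = scale (Poly_Mapping.lookup x (\<omega>, [], \<omega>)) v"
proof -
  let ?e = "(v0, [], v0)" and ?f = "(\<omega>, [], \<omega>)"
  have ends: "p = ?e" if "p \<in> Poly_Mapping.keys x" "snd (snd p) = v0" for p
  proof (cases p)
    case (fields u es w)
    have "awalk u es v0"
      using that x fields by (auto simp: pcarrier_def quiver_paths_def)
    then show ?thesis
      using assms(1) fields that by (cases es rule: rev_cases) (auto simp: awalk_simps in_arcs_def)
  qed
  have starts: "p = ?f" if "p \<in> Poly_Mapping.keys x" "fst p = \<omega>" for p
  proof (cases p)
    case (fields u es w)
    have "awalk \<omega> es w"
      using that x fields by (auto simp: pcarrier_def quiver_paths_def)
    then show ?thesis
      using assms(2) fields that by (cases es) (auto simp: awalk_simps out_arcs_def)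
  qed
  have q: "fst q = v0" "snd (snd q) = \<omega>" if "q \<in> Poly_Mapping.keys v" for q
    using that v by (auto simp: branches_def)
  \<comment> \<open>Inserting the trivial path keeps it in the index set even if its coefficient in
    \<open>x\<close> is 0, so the sum collapses to this one term without a case distinction.\<close>
  have "pmul x v = (\<Sum>p\<in>insert ?e (Poly_Mapping.keys x). \<Sum>q\<in>Poly_Mapping.keys v.
      path_mult p q (Poly_Mapping.lookup x p * Poly_Mapping.lookup v q))"
    by (rule pmul_superset) auto
  also have "\<dots> = (\<Sum>p\<in>insert ?e (Poly_Mapping.keys x).
      if p = ?e then scale (Poly_Mapping.lookup x ?e) v else 0)"
  proof (intro sum.cong refl)
    fix p assume p: "p \<in> insert ?e (Poly_Mapping.keys x)"
    show "(\<Sum>q\<in>Poly_Mapping.keys v. path_mult p q (Poly_Mapping.lookup x p * Poly_Mapping.lookup v q))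
        = (if p = ?e then scale (Poly_Mapping.lookup x ?e) v else 0)"
    proof (cases "p = ?e")
      case True
      have "(\<Sum>q\<in>Poly_Mapping.keys v. path_mult p q (Poly_Mapping.lookup x p * Poly_Mapping.lookup v q))
        = (\<Sum>q\<in>Poly_Mapping.keys v. scale (Poly_Mapping.lookup x p) (Poly_Mapping.single q (Poly_Mapping.lookup v q)))"
        using True q by (intro sum.cong) (auto simp: path_mult_def)
      then show ?thesis
        using True by (simp only: scale_sum[symmetric] sum_single_lookup if_True simp_thms)
    next
      case False
      then have "snd (snd p) \<noteq> v0" using p ends[of p] by blast
      then show ?thesis using False q by (auto simp: path_mult_def intro!: sum.neutral)
    qed
  qed
  finally show "pmul x v = scale (Poly_Mapping.lookup x ?e) v" by simp
  have "pmul v x = (\<Sum>q\<in>Poly_Mapping.keys v. \<Sum>p\<in>insert ?f (Poly_Mapping.keys x).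
      path_mult q p (Poly_Mapping.lookup v q * Poly_Mapping.lookup x p))"
    by (rule pmul_superset) auto
  also have "\<dots> = (\<Sum>q\<in>Poly_Mapping.keys v.
      scale (Poly_Mapping.lookup x ?f) (Poly_Mapping.single q (Poly_Mapping.lookup v q)))"
  proof (intro sum.cong refl)
    fix q assume "q \<in> Poly_Mapping.keys v"
    note q = q[OF this]
    have "(\<Sum>p\<in>insert ?f (Poly_Mapping.keys x).
        path_mult q p (Poly_Mapping.lookup v q * Poly_Mapping.lookup x p)) =
        (\<Sum>p\<in>insert ?f (Poly_Mapping.keys x). if p = ?f then
           Poly_Mapping.single q (Poly_Mapping.lookup v q * Poly_Mapping.lookup x ?f) else 0)"
      using q starts by (intro sum.cong refl) (cases q, auto simp: path_mult_def)
    then show "(\<Sum>p\<in>insert ?f (Poly_Mapping.keys x).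
        path_mult q p (Poly_Mapping.lookup v q * Poly_Mapping.lookup x p)) =
        scale (Poly_Mapping.lookup x ?f) (Poly_Mapping.single q (Poly_Mapping.lookup v q))"
      by (simp add: mult.commute)
  qed
  finally show "pmul v x = scale (Poly_Mapping.lookup x ?f) v"
    by (simp only: scale_sum[symmetric] sum_single_lookup)
qed

lemma contains_monomial_append:
  "contains_monomial M p \<or> contains_monomial M q \<Longrightarrow>
     contains_monomial M (u, fst (snd p) @ fst (snd q), v)"
  unfolding contains_monomial_def by (auto simp: sublist_append)

lemma ideal_monomial_span: "ideal (monomial_span G M :: (('a, 'b) path \<Rightarrow>\<^sub>0 'k::field_char_0) set) (path_algebra G)"
proof (rule ideal_path_algebraI)
  fix x y :: "('a, 'b) path \<Rightarrow>\<^sub>0 'k"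
  show "x + y \<in> monomial_span G M" if "x \<in> monomial_span G M" "y \<in> monomial_span G M"
    using that Poly_Mapping.keys_add[of x y] by (auto simp: monomial_span_def pcarrier_add)
  show "pmul x y \<in> monomial_span G M" if "x \<in> pcarrier G" "y \<in> monomial_span G M"
    using that contains_monomial_append
    by (fastforce simp: monomial_span_def pcarrier_pmul elim: keys_pmul)
  show "pmul x y \<in> monomial_span G M" if "x \<in> monomial_span G M" "y \<in> pcarrier G"
    using that contains_monomial_append
    by (fastforce simp: monomial_span_def pcarrier_pmul elim: keys_pmul)
qed (auto simp: monomial_span_def)

lemma monomial_span_subset_genideal:
  assumes M: "M \<subseteq> quiver_paths G" "\<And>p. p \<in> M \<Longrightarrow> 0 < path_length p"
    and J: "ideal J (path_algebra G)" "monomials M \<subseteq> J"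
  shows "monomial_span G M \<subseteq> (J :: (('a, 'b) path \<Rightarrow>\<^sub>0 'k::field_char_0) set)"
proof
  fix x :: "('a, 'b) path \<Rightarrow>\<^sub>0 'k" assume x: "x \<in> monomial_span G M"
  have "Poly_Mapping.single p c \<in> J" if "p \<in> Poly_Mapping.keys x" for p c
  proof -
    obtain u es v where p: "p = (u, es, v)" by (cases p)
    have path: "(u, es, v) \<in> quiver_paths G" and "contains_monomial M p"
      using that x p by (auto simp: monomial_span_def pcarrier_def)
    then obtain m where m: "m \<in> M" and "sublist (fst (snd m)) es"
      by (auto simp: contains_monomial_def p)
    then obtain s t where es: "es = s @ fst (snd m) @ t" by (auto simp: sublist_def)
    obtain u' ms v' where m_eq: "m = (u', ms, v')" by (cases m)
    have ms: "(u', ms, v') \<in> quiver_paths G" "ms \<noteq> []"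
      using m m_eq M(1) M(2)[OF m] by (auto simp: path_length_def)
    from path obtain w w' where ww: "(u, s, w) \<in> quiver_paths G" "(w, ms, w') \<in> quiver_paths G"
        "(w', t, v) \<in> quiver_paths G"
      unfolding es m_eq by (auto elim!: quiver_paths_appendE)
    \<comment> \<open>The occurrence of the monomial in the path and the monomial itself have the
      same nonempty arrow list, so the three factors compose.\<close>
    with ms have w: "w = u'" "w' = v'" using quiver_paths_ends_unique by blast+
    have "Poly_Mapping.single m 1 \<in> J" using m J by (auto simp: monomials_def)
    then have "pmul (pmul (Poly_Mapping.single (u, s, w) c) (Poly_Mapping.single m 1))
        (Poly_Mapping.single (w', t, v) 1) \<in> J"
      using ww by (intro ideal_pmul_right[OF J(1)] ideal_pmul_left[OF J(1)] pcarrier_single)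
    then show ?thesis using w by (simp add: p es m_eq path_mult_def)
  qed
  then have "(\<Sum>p\<in>Poly_Mapping.keys x. Poly_Mapping.single p (Poly_Mapping.lookup x p)) \<in> J"
    by (intro ideal_sum[OF J(1)])
  then show "x \<in> J" by (simp add: sum_single_lookup)
qed

text \<open>By \<open>pmul_branches\<close> a product with \<open>a\<close> rescales all
  coefficients of the \<rho> part by one coefficient of \<open>a\<close>, that of the trivial path
  at \<open>v0\<close> or at \<omega>. The right-hand side is therefore already an ideal, and no
  products with paths appear in it.\<close>

lemma genideal_monomials_branches:
  fixes \<rho> :: "nat \<Rightarrow> ('a, 'b) path \<Rightarrow>\<^sub>0 'k::field_char_0"
  assumes M: "M \<subseteq> quiver_paths G" "\<And>p. p \<in> M \<Longrightarrow> 0 < path_length p"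
    and ends: "in_arcs G v0 = {}" "out_arcs G \<omega> = {}"
    and \<rho>: "\<And>i. i < r \<Longrightarrow> Poly_Mapping.keys (\<rho> i) \<subseteq> branches G v0 \<omega>"
  shows "Idl\<^bsub>path_algebra G\<^esub> (monomials M \<union> \<rho> ` {..<r}) =
    {x + (\<Sum>i<r. scale (d i) (\<rho> i)) | x d. x \<in> monomial_span G M}" (is "_ = ?K")
proof
  have br: "branches G v0 \<omega> \<subseteq> quiver_paths G" by (auto simp: branches_def)
  have carr: "monomials M \<union> \<rho> ` {..<r} \<subseteq> pcarrier G"
    using M(1) \<rho> br by (fastforce simp: monomials_def pcarrier_def)
  have \<rho>_carr: "\<rho> i \<in> pcarrier G" if "i < r" for i
    using that carr by auto
  note S = genideal_is_ideal[OF carr]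
  show "?K \<subseteq> Idl\<^bsub>path_algebra G\<^esub> (monomials M \<union> \<rho> ` {..<r})" (is "_ \<subseteq> ?J")
  proof safe
    fix x :: "('a, 'b) path \<Rightarrow>\<^sub>0 'k" and d assume x: "x \<in> monomial_span G M"
    have gens: "monomials M \<union> \<rho> ` {..<r} \<subseteq> ?J"
      by (rule genideal_superset)
    then have "monomials M \<subseteq> ?J" by simp
    from subsetD[OF monomial_span_subset_genideal[OF M S this] x] have "x \<in> ?J" .
    moreover have "\<rho> i \<in> ?J" if "i < r" for i
      using that gens by auto
    ultimately show "x + (\<Sum>i<r. scale (d i) (\<rho> i)) \<in> ?J"
      by (intro ideal_add[OF S] ideal_sum[OF S] ideal_scale[OF S]) auto
  qed
  note N = ideal_monomial_span[of M, where 'k = 'k]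
  have "ideal ?K (path_algebra G)"
  proof (rule ideal_path_algebraI)
    show "?K \<subseteq> pcarrier G"
      using ideal_subset_pcarrier[OF N] \<rho>_carr
      by (auto intro!: pcarrier_add pcarrier_sum pcarrier_scale)
    show "0 \<in> ?K"
      using ideal_zero[OF N] by (intro CollectI exI[of _ 0] exI[of _ "\<lambda>_. 0"]) simp
  next
    fix a b :: "('a, 'b) path \<Rightarrow>\<^sub>0 'k" assume "a \<in> ?K" "b \<in> ?K"
    then obtain x d y f where a: "a = x + (\<Sum>i<r. scale (d i) (\<rho> i))" "x \<in> monomial_span G M"
      and b: "b = y + (\<Sum>i<r. scale (f i) (\<rho> i))" "y \<in> monomial_span G M" by blast
    have "a + b = (x + y) + (\<Sum>i<r. scale (d i + f i) (\<rho> i))"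
      by (simp add: a b scale_add_left sum.distrib)
    moreover have "x + y \<in> monomial_span G M" using a b by (intro ideal_add[OF N])
    ultimately show "a + b \<in> ?K" by (intro CollectI exI[of _ "x + y"] exI[of _ "\<lambda>i. d i + f i"]) simp
  next
    fix a b :: "('a, 'b) path \<Rightarrow>\<^sub>0 'k" assume a: "a \<in> pcarrier G" and "b \<in> ?K"
    then obtain y f where b: "b = y + (\<Sum>i<r. scale (f i) (\<rho> i))" "y \<in> monomial_span G M" by blast
    have "pmul a b = pmul a y + (\<Sum>i<r. scale (f i * Poly_Mapping.lookup a (v0, [], v0)) (\<rho> i))"
      using \<rho> by (simp add: b pmul_add_right pmul_sum_right pmul_scale_right
          pmul_branches(1)[OF ends _ a])
    moreover have "pmul a y \<in> monomial_span G M" using a b by (intro ideal_pmul_left[OF N])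
    ultimately show "pmul a b \<in> ?K"
      by (intro CollectI exI[of _ "pmul a y"] exI[of _ "\<lambda>i. f i * Poly_Mapping.lookup a (v0, [], v0)"]) simp
  next
    fix a b :: "('a, 'b) path \<Rightarrow>\<^sub>0 'k" assume "a \<in> ?K" and b: "b \<in> pcarrier G"
    then obtain y f where a: "a = y + (\<Sum>i<r. scale (f i) (\<rho> i))" "y \<in> monomial_span G M" by blast
    have "pmul a b = pmul y b + (\<Sum>i<r. scale (f i * Poly_Mapping.lookup b (\<omega>, [], \<omega>)) (\<rho> i))"
      using \<rho> by (simp add: a pmul_add_left pmul_sum_left pmul_scale_left
          pmul_branches(2)[OF ends _ b])
    moreover have "pmul y b \<in> monomial_span G M" using a b by (intro ideal_pmul_right[OF N])
    ultimately show "pmul a b \<in> ?K"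
      by (intro CollectI exI[of _ "pmul y b"] exI[of _ "\<lambda>i. f i * Poly_Mapping.lookup b (\<omega>, [], \<omega>)"]) simp
  qed
  then show "Idl\<^bsub>path_algebra G\<^esub> (monomials M \<union> \<rho> ` {..<r}) \<subseteq> ?K"
  proof (rule genideal_least)
    have "Poly_Mapping.single p 1 \<in> monomial_span G M" if "p \<in> M" for p
      using that M by (auto simp: monomial_span_def pcarrier_single contains_monomial_def)
    then have "z \<in> ?K" if "z \<in> monomials M" for z
      using that by (intro CollectI exI[of _ z] exI[of _ "\<lambda>_. 0"]) (auto simp: monomials_def)
    moreover have "\<rho> i \<in> ?K" if "i < r" for i
    proof -
      have "(\<Sum>j<r. scale (if j = i then 1 else 0) (\<rho> j)) = (\<Sum>j<r. if j = i then \<rho> i else 0)"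
        by (intro sum.cong) auto
      also have "\<dots> = \<rho> i" using that by simp
      finally show ?thesis
        using ideal_zero[OF N] by (intro CollectI exI[of _ 0] exI[of _ "\<lambda>j. if j = i then 1 else 0"]) simp
    qed
    ultimately show "monomials M \<union> \<rho> ` {..<r} \<subseteq> ?K" by blast
  qed
qed

end

section \<open>Quotients of the path algebra\<close>

lemma quotient_algebra_simps [simp]:
  "carrier (quotient_algebra A J) = a_rcosets\<^bsub>A\<^esub> J"
  "mult (quotient_algebra A J) = rcoset_mult A J"
  "one (quotient_algebra A J) = J +>\<^bsub>A\<^esub> \<one>\<^bsub>A\<^esub>"
  "zero (quotient_algebra A J) = J"
  "add (quotient_algebra A J) = set_add A"
  "module.smult (quotient_algebra A J) = coset_smult A J"
  by (simp_all add: quotient_algebra_def ring.defs module.defs FactRing_def)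

text \<open>\<open>quotient_algebra A J\<close> is a record extension of \<open>A Quot J\<close>, so
  the ring axioms are carried over selector by selector.\<close>

lemma ring_quotient_algebra:
  assumes "ideal J A"
  shows "ring (quotient_algebra A J)"
proof -
  interpret Q: ring "A Quot J"
    using assms by (rule ideal.quotient_is_ring)
  have sel: "carrier (A Quot J) = a_rcosets\<^bsub>A\<^esub> J" "mult (A Quot J) = rcoset_mult A J"
    "one (A Quot J) = J +>\<^bsub>A\<^esub> \<one>\<^bsub>A\<^esub>" "zero (A Quot J) = J" "add (A Quot J) = set_add A"
    by (simp_all add: FactRing_def)
  show ?thesis
  proof (rule ringI)
    show "abelian_group (quotient_algebra A J)"
    proof (rule abelian_groupI)
      fix x assume "x \<in> carrier (quotient_algebra A J)"
      then have "x \<in> carrier (A Quot J)" by (simp add: sel)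
      from Q.a_inv_closed[OF this] Q.l_neg[OF this]
      show "\<exists>y\<in>carrier (quotient_algebra A J). y \<oplus>\<^bsub>quotient_algebra A J\<^esub> x = \<zero>\<^bsub>quotient_algebra A J\<^esub>"
        unfolding quotient_algebra_simps sel by blast
    qed (use Q.a_closed Q.zero_closed Q.a_assoc Q.a_comm Q.l_zero in
        \<open>simp_all only: quotient_algebra_simps sel\<close>)
    show "Group.monoid (quotient_algebra A J)"
      by (rule monoidI) (use Q.m_closed Q.one_closed Q.m_assoc Q.l_one Q.r_one in
        \<open>simp_all only: quotient_algebra_simps sel\<close>)
  qed (use Q.l_distr Q.r_distr in \<open>simp_all only: quotient_algebra_simps sel\<close>)
qed

context fin_digraph
begin

abbreviation residue :: "(('a, 'b) path \<Rightarrow>\<^sub>0 'k::field_char_0) set \<Rightarrow> (('a, 'b) path \<Rightarrow>\<^sub>0 'k)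
    \<Rightarrow> (('a, 'b) path \<Rightarrow>\<^sub>0 'k) set" where
  "residue J x \<equiv> J +>\<^bsub>path_algebra G\<^esub> x"

lemma residue_def': "residue J x = {j + x | j. j \<in> J}"
  by (auto simp: a_r_coset_def')

context
  fixes J :: "(('a, 'b) path \<Rightarrow>\<^sub>0 'k::field_char_0) set"
  assumes J: "ideal J (path_algebra G)"
begin

interpretation ideal J "path_algebra G" by (rule J)

lemma mem_residue_iff: "x \<in> pcarrier G \<Longrightarrow> y \<in> residue J x \<longleftrightarrow> y - x \<in> J"
  by (force simp: residue_def')

lemma residue_eq_iff: "x \<in> pcarrier G \<Longrightarrow> y \<in> pcarrier G \<Longrightarrow> residue J x = residue J y \<longleftrightarrow> x - y \<in> J"
  using quotient_eq_iff_same_a_r_cos[OF J, of x y] by simp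

lemma residue_self: "x \<in> pcarrier G \<Longrightarrow> x \<in> residue J x"
  using ideal_zero[OF J] by (force simp: residue_def')

lemma residue_zero [simp]: "residue J 0 = J"
  by (simp add: residue_def')

lemma a_rcosets_residue: "a_rcosets\<^bsub>path_algebra G\<^esub> J = residue J ` pcarrier G"
  by (auto simp: A_RCOSETS_defs a_r_coset_def r_coset_def)

lemma residue_mult:
  "x \<in> pcarrier G \<Longrightarrow> y \<in> pcarrier G \<Longrightarrow>
     rcoset_mult (path_algebra G) J (residue J x) (residue J y) = residue J (pmul x y)"
  using rcoset_mult_add[of x y] by simp

lemma residue_add:
  "x \<in> pcarrier G \<Longrightarrow> y \<in> pcarrier G \<Longrightarrow>
     residue J x <+>\<^bsub>path_algebra G\<^esub> residue J y = residue J (x + y)"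
  using a_rcos_sum[of x y] by simp

text \<open>\<open>coset_smult\<close> is a union over all representatives. Since \<open>J\<close>
  is closed under scalars, every member of this union is the same coset.\<close>

lemma residue_smult:
  assumes "x \<in> pcarrier G"
  shows "coset_smult (path_algebra G) J c (residue J x) = residue J (scale c x)"
proof -
  have "residue J (scale c y) = residue J (scale c x)" if "y \<in> residue J x" for y
  proof -
    have "y - x \<in> J" using that assms by (simp add: mem_residue_iff)
    then have "y \<in> pcarrier G" "scale c (y - x) \<in> J"
      using pcarrier_add[OF subsetD[OF ideal_subset_pcarrier[OF J]] assms, of "y - x"] ideal_scale[OF J]
      by simp_all
    moreover have "scale c (y - x) = scale c y - scale c x"
      by (rule poly_mapping_eqI) (simp add: lookup_minus right_diff_distrib)
    ultimately show ?thesis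
      using assms by (simp add: residue_eq_iff pcarrier_scale)
  qed
  then have "coset_smult (path_algebra G) J c (residue J x) =
      (\<Union>y\<in>residue J x. residue J (scale c x))"
    unfolding coset_smult_def path_algebra_simps by (intro SUP_cong refl)
  also have "\<dots> = residue J (scale c x)"
    using residue_self[OF assms] by (intro UN_constant_eq) auto
  finally show ?thesis .
qed

end

end

locale admissible_quotient = fin_digraph +
  fixes I :: "(('a, 'b) path \<Rightarrow>\<^sub>0 'k::field_char_0) set"
  assumes admissible: "admissible_ideal G I"
begin

abbreviation "A \<equiv> quotient_algebra (path_algebra G) I"

text \<open>These images turn out to be the powers of the radical
  (\<open>rad_power_A\<close>).\<close>

definition resid_pfilt :: "nat \<Rightarrow> (('a, 'b) path \<Rightarrow>\<^sub>0 'k) set set" where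
  "resid_pfilt t = residue I ` pfilt G t"

lemma I_ideal: "ideal I (path_algebra G)" and I_pfilt: "I \<subseteq> pfilt G 2"
  using admissible by (auto simp: admissible_ideal_iff)

lemma I_pcarrier: "x \<in> I \<Longrightarrow> x \<in> pcarrier G"
  using ideal_subset_pcarrier[OF I_ideal] by blast

sublocale A: ring A
  by (rule ring_quotient_algebra[OF I_ideal])

lemma carrier_A: "carrier A = residue I ` pcarrier G"
  by (simp add: a_rcosets_residue[OF I_ideal])

lemma residue_in_carrier: "x \<in> pcarrier G \<Longrightarrow> residue I x \<in> carrier A"
  by (simp add: a_rcosets_residue[OF I_ideal])

lemma A_mult: "x \<in> pcarrier G \<Longrightarrow> y \<in> pcarrier G \<Longrightarrow>
    residue I x \<otimes>\<^bsub>A\<^esub> residue I y = residue I (pmul x y)"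
  by (simp add: residue_mult[OF I_ideal])

lemma A_add: "x \<in> pcarrier G \<Longrightarrow> y \<in> pcarrier G \<Longrightarrow>
    residue I x \<oplus>\<^bsub>A\<^esub> residue I y = residue I (x + y)"
  by (simp add: residue_add[OF I_ideal])

lemma A_smult: "x \<in> pcarrier G \<Longrightarrow> c \<odot>\<^bsub>A\<^esub> residue I x = residue I (scale c x)"
  by (simp add: residue_smult[OF I_ideal])

lemma A_zero: "\<zero>\<^bsub>A\<^esub> = residue I 0"
  by (simp add: residue_zero[OF I_ideal])

lemma A_one: "\<one>\<^bsub>A\<^esub> = residue I (pone G)"
  by simp

lemma A_uminus: "x \<in> pcarrier G \<Longrightarrow> \<ominus>\<^bsub>A\<^esub> residue I x = residue I (- x)"
  using A.minus_equality[of "residue I (- x)" "residue I x"]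
  by (simp add: A_add A_zero residue_in_carrier pcarrier_uminus del: quotient_algebra_simps)

lemma A_minus: "x \<in> pcarrier G \<Longrightarrow> y \<in> pcarrier G \<Longrightarrow>
    residue I x \<ominus>\<^bsub>A\<^esub> residue I y = residue I (x - y)"
  by (simp add: a_minus_def A_uminus A_add pcarrier_uminus del: quotient_algebra_simps)

lemma additive_subgroup_residueI:
  assumes "L \<subseteq> pcarrier G" "0 \<in> L" "\<And>x y. x \<in> L \<Longrightarrow> y \<in> L \<Longrightarrow> x + y \<in> L"
    "\<And>x. x \<in> L \<Longrightarrow> - x \<in> L"
  shows "additive_subgroup (residue I ` L) A"
proof (rule additive_subgroupI, rule A.add.subgroupI)
  show "residue I ` L \<subseteq> carrier A"
    using assms(1) residue_in_carrier by auto
  show "residue I ` L \<noteq> {}"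
    using assms(2) by blast
next
  fix a assume "a \<in> residue I ` L"
  then show "\<ominus>\<^bsub>A\<^esub> a \<in> residue I ` L"
    using assms(1,4) by (auto simp: A_uminus subset_iff simp del: quotient_algebra_simps)
next
  fix a b assume "a \<in> residue I ` L" "b \<in> residue I ` L"
  then obtain x y where xy: "a = residue I x" "b = residue I y" "x \<in> L" "y \<in> L" by blast
  then have "x \<in> pcarrier G" "y \<in> pcarrier G" using assms(1) by blast+
  then have "a \<oplus>\<^bsub>A\<^esub> b = residue I (x + y)"
    unfolding xy by (rule A_add)
  then show "a \<oplus>\<^bsub>A\<^esub> b \<in> residue I ` L"
    using assms(3) xy by blast
qed

lemma ideal_residue_image:
  assumes "ideal L (path_algebra G)"
  shows "ideal (residue I ` L) A"
proof (intro ideal.intro ideal_axioms.intro additive_subgroup_residueI A.ring_axioms)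
  note L = ideal_subset_pcarrier[OF assms]
  show "L \<subseteq> pcarrier G" by (rule L)
  show "0 \<in> L" by (rule ideal_zero[OF assms])
  show "\<And>x y. x \<in> L \<Longrightarrow> y \<in> L \<Longrightarrow> x + y \<in> L" by (rule ideal_add[OF assms])
  show "\<And>x. x \<in> L \<Longrightarrow> - x \<in> L" by (rule ideal_uminus[OF assms])
  fix a b assume "a \<in> residue I ` L" "b \<in> carrier A"
  then obtain x y where ab: "a = residue I x" "b = residue I y" and x: "x \<in> L" and y: "y \<in> pcarrier G"
    unfolding carrier_A by blast
  have "pmul y x \<in> L" "pmul x y \<in> L"
    using x y assms by (auto intro: ideal_pmul_left ideal_pmul_right)
  moreover have "b \<otimes>\<^bsub>A\<^esub> a = residue I (pmul y x)" "a \<otimes>\<^bsub>A\<^esub> b = residue I (pmul x y)"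
    unfolding ab using x y L by (auto simp only: A_mult)
  ultimately show "b \<otimes>\<^bsub>A\<^esub> a \<in> residue I ` L" "a \<otimes>\<^bsub>A\<^esub> b \<in> residue I ` L"
    by auto
qed

lemma ideal_resid_pfilt: "ideal (resid_pfilt t) A"
  unfolding resid_pfilt_def by (rule ideal_residue_image[OF ideal_pfilt])

lemma residue_in_resid_pfilt_iff:
  assumes "x \<in> pcarrier G"
  shows "residue I x \<in> resid_pfilt t \<longleftrightarrow> (\<exists>f\<in>pfilt G t. x - f \<in> I)"
  using residue_eq_iff[OF I_ideal assms] subsetD[OF pfilt_subset]
  unfolding resid_pfilt_def by blast

section \<open>The radical\<close>

text \<open>A concatenation is trivial only if both factors are. So reading off the coefficient at a
  vertex is multiplicative, and each vertex yields a one-dimensional quotient of the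
  algebra.\<close>

lemma lookup_trivial_path_pmul:
  fixes x y :: "('a, 'b) path \<Rightarrow>\<^sub>0 'k"
  assumes "x \<in> pcarrier G" "y \<in> pcarrier G"
  shows "Poly_Mapping.lookup (pmul x y) (v, [], v) =
     Poly_Mapping.lookup x (v, [], v) * Poly_Mapping.lookup y (v, [], v)"
proof -
  let ?e = "(v, [], v)"
  let ?X = "insert ?e (Poly_Mapping.keys x)" and ?Y = "insert ?e (Poly_Mapping.keys y)"
  let ?c = "\<lambda>p q. Poly_Mapping.lookup x p * Poly_Mapping.lookup y q"
  \<comment> \<open>A triple with empty arrow list may have different ends; being a quiver path
    forces them to agree.\<close>
  have trivial: "w = u" if "(u, [], w) \<in> ?X \<union> ?Y" for u w
    using that assms by (auto simp: pcarrier_def quiver_paths_def awalk_Nil_iff)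
  have "pmul x y = (\<Sum>p\<in>?X. \<Sum>q\<in>?Y. path_mult p q (?c p q))"
    by (rule pmul_superset) auto
  then have "Poly_Mapping.lookup (pmul x y) ?e =
      (\<Sum>p\<in>?X. \<Sum>q\<in>?Y. Poly_Mapping.lookup (path_mult p q (?c p q)) ?e)"
    by (simp only: lookup_sum)
  also have "\<dots> = (\<Sum>p\<in>?X. \<Sum>q\<in>?Y. if q = ?e then if p = ?e then ?c ?e ?e else 0 else 0)"
  proof (intro sum.cong refl)
    fix p q assume pq: "p \<in> ?X" "q \<in> ?Y"
    obtain a b c where p: "p = (a, b, c)" by (cases p)
    obtain a' b' c' where q: "q = (a', b', c')" by (cases q)
    show "Poly_Mapping.lookup (path_mult p q (?c p q)) ?e =
        (if q = ?e then if p = ?e then ?c ?e ?e else 0 else 0)"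
      using pq trivial[of a c] trivial[of a' c'] unfolding p q
      by (cases "b = [] \<and> b' = []") (auto simp: path_mult_def lookup_single when_def)
  qed
  also have "\<dots> = (\<Sum>p\<in>?X. if p = ?e then ?c ?e ?e else 0)"
    by (intro sum.cong refl) simp
  also have "\<dots> = ?c ?e ?e" by simp
  finally show ?thesis .
qed

text \<open>Hence the coefficient at a vertex is well defined on the quotient by
  \<open>I\<close>.\<close>

lemma lookup_trivial_path_I:
  assumes "x \<in> I"
  shows "Poly_Mapping.lookup x (v, [], v) = 0"
proof -
  have "x \<in> pfilt G 2" using assms I_pfilt by blast
  then have "(v, [], v) \<notin> Poly_Mapping.keys x"
    by (auto simp: pfilt_def path_length_def)
  then show ?thesis by (simp add: in_keys_iff)
qed

definition vertex_kernel :: "'a \<Rightarrow> (('a, 'b) path \<Rightarrow>\<^sub>0 'k) set" where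
  "vertex_kernel v = {x \<in> pcarrier G. Poly_Mapping.lookup x (v, [], v) = 0}"

lemma residue_vertex_kernel_iff:
  assumes "x \<in> pcarrier G"
  shows "residue I x \<in> residue I ` vertex_kernel v \<longleftrightarrow> x \<in> vertex_kernel v"
proof
  assume "residue I x \<in> residue I ` vertex_kernel v"
  then obtain y where y: "y \<in> vertex_kernel v" "residue I x = residue I y" by blast
  then have "x - y \<in> I"
    using assms residue_eq_iff[OF I_ideal] by (auto simp: vertex_kernel_def)
  from lookup_trivial_path_I[OF this, of v] y assms show "x \<in> vertex_kernel v"
    by (simp add: vertex_kernel_def lookup_minus)
qed blast

lemma ideal_vertex_kernel: "ideal (vertex_kernel v) (path_algebra G)"
  by (rule ideal_path_algebraI)
    (auto simp: vertex_kernel_def lookup_add pcarrier_add pcarrier_pmul lookup_trivial_path_pmul)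

text \<open>Pulling \<open>K\<close> back to the path algebra allows computations with elements
  instead of cosets.\<close>

lemma left_ideal_residue_vimage:
  assumes "left_ideal K A"
  defines "L \<equiv> {x \<in> pcarrier G. residue I x \<in> K}"
  shows "K = residue I ` L" "0 \<in> L" "\<And>x y. x \<in> L \<Longrightarrow> y \<in> L \<Longrightarrow> x + y \<in> L"
    "\<And>x y. x \<in> pcarrier G \<Longrightarrow> y \<in> L \<Longrightarrow> pmul x y \<in> L"
proof -
  interpret K: additive_subgroup K A using assms(1) by (simp add: left_ideal_def)
  show "K = residue I ` L"
    using K.a_subset unfolding carrier_A L_def by blast
  show "0 \<in> L"
    using K.zero_closed unfolding L_def A_zero by simp
  show "x + y \<in> L" if "x \<in> L" "y \<in> L" for x y
  proof -
    have "residue I x \<oplus>\<^bsub>A\<^esub> residue I y \<in> K"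
      using that by (intro K.a_closed) (auto simp only: L_def)
    then show ?thesis
      using that by (simp add: A_add L_def pcarrier_add del: quotient_algebra_simps)
  qed
  show "pmul x y \<in> L" if "x \<in> pcarrier G" "y \<in> L" for x y
  proof -
    have "residue I x \<otimes>\<^bsub>A\<^esub> residue I y \<in> K"
      using that assms(1) residue_in_carrier by (auto simp only: left_ideal_def L_def)
    then show ?thesis
      using that by (simp add: A_mult L_def pcarrier_pmul del: quotient_algebra_simps)
  qed
qed

lemma left_ideal_residueI:
  assumes "L \<subseteq> pcarrier G" "0 \<in> L" "\<And>x y. x \<in> L \<Longrightarrow> y \<in> L \<Longrightarrow> x + y \<in> L"
    and mult: "\<And>x y. x \<in> pcarrier G \<Longrightarrow> y \<in> L \<Longrightarrow> pmul x y \<in> L"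
  shows "left_ideal (residue I ` L) A"
  unfolding left_ideal_def
proof safe
  have minus: "- x \<in> L" if "x \<in> L" for x
  proof -
    have "x \<in> pcarrier G" using assms(1) that by blast
    then have "- x = pmul (scale (-1) (pone G)) x"
      by (subst pmul_scale_pone) (simp_all only: scale_minus_one)
    also have "\<dots> \<in> L"
      using that by (intro mult pcarrier_scale pcarrier_pone)
    finally show ?thesis .
  qed
  show "additive_subgroup (residue I ` L) A"
    by (rule additive_subgroup_residueI) (use assms minus in auto)
  fix a x assume "a \<in> carrier A" and x: "x \<in> L"
  then obtain y where y: "y \<in> pcarrier G" "a = residue I y" unfolding carrier_A by blast
  have "a \<otimes>\<^bsub>A\<^esub> residue I x = residue I (pmul y x)"
    unfolding y(2) using y(1) x assms(1) by (intro A_mult) auto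
  then show "a \<otimes>\<^bsub>A\<^esub> residue I x \<in> residue I ` L"
    using mult[OF y(1) x] by simp
qed

text \<open>The kernel has codimension one: modulo it, every element is a scalar multiple of any
  \<open>y\<close> outside it.\<close>

lemma maximal_left_ideal_vertex_kernel:
  assumes "v \<in> verts G"
  shows "maximal_left_ideal (residue I ` vertex_kernel v) A"
  unfolding maximal_left_ideal_def
proof (intro conjI allI impI)
  note V = ideal_vertex_kernel[of v]
  show "left_ideal (residue I ` vertex_kernel v) A"
    by (intro left_ideal_residueI ideal_subset_pcarrier[OF V] ideal_zero[OF V] ideal_add[OF V]
        ideal_pmul_left[OF V])
  let ?e = "Poly_Mapping.single (v, [], v) 1 :: ('a, 'b) path \<Rightarrow>\<^sub>0 'k"
  have e: "?e \<in> pcarrier G"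
    using assms by (intro pcarrier_single) (auto simp: quiver_paths_def awalk_Nil_iff)
  have "residue I ?e \<notin> residue I ` vertex_kernel v"
    unfolding residue_vertex_kernel_iff[OF e] by (simp add: vertex_kernel_def)
  then show "residue I ` vertex_kernel v \<noteq> carrier A"
    using residue_in_carrier[OF e] by metis
  fix K assume K: "left_ideal K A" and sub: "residue I ` vertex_kernel v \<subseteq> K"
  define L where "L = {x \<in> pcarrier G. residue I x \<in> K}"
  note L = left_ideal_residue_vimage[OF K, folded L_def]
  have VL: "vertex_kernel v \<subseteq> L"
    using sub ideal_subset_pcarrier[OF V] by (auto simp: L_def)
  show "K = residue I ` vertex_kernel v \<or> K = carrier A"
  proof (cases "L = vertex_kernel v")
    case False
    then obtain y where y: "y \<in> L" "y \<notin> vertex_kernel v" using VL by blast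
    then have y_carr: "y \<in> pcarrier G" and c: "Poly_Mapping.lookup y (v, [], v) \<noteq> 0"
      by (auto simp: L_def vertex_kernel_def)
    have "z \<in> L" if z: "z \<in> pcarrier G" for z
    proof -
      \<comment> \<open>Chosen so that the coefficients of \<open>z\<close> and
        \<open>scale d y\<close> at the vertex cancel.\<close>
      define d where "d = Poly_Mapping.lookup z (v, [], v) / Poly_Mapping.lookup y (v, [], v)"
      have "pmul (scale d (pone G)) y \<in> L"
        using y by (intro L pcarrier_scale pcarrier_pone)
      then have "scale d y \<in> L" using y_carr by (simp add: pmul_scale_pone)
      moreover have "z - scale d y \<in> vertex_kernel v"
        using z y_carr c by (auto simp: vertex_kernel_def pcarrier_diff pcarrier_scale lookup_minus d_def)
      ultimately have "(z - scale d y) + scale d y \<in> L"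
        using VL by (intro L(3)) auto
      then show ?thesis by simp
    qed
    then have "carrier A \<subseteq> K"
      unfolding L(1) carrier_A by blast
    moreover have "K \<subseteq> carrier A"
      unfolding L(1) carrier_A by (auto simp: L_def)
    ultimately show ?thesis by blast
  qed (use L(1) in blast)
qed

lemma pfilt_1_vertex_kernel:
  assumes "x \<in> pcarrier G" "\<And>v. v \<in> verts G \<Longrightarrow> x \<in> vertex_kernel v"
  shows "x \<in> pfilt G 1"
proof -
  have "1 \<le> path_length p" if p: "p \<in> Poly_Mapping.keys x" for p
  proof (cases p)
    case (fields u es w)
    have "(u, es, w) \<in> quiver_paths G" using p fields assms(1) by (auto simp: pcarrier_def)
    moreover have "(u, [], u) \<notin> Poly_Mapping.keys x" if "u \<in> verts G"
      using assms(2)[OF that] by (simp add: vertex_kernel_def in_keys_iff)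
    ultimately show ?thesis
      using p fields by (cases es) (auto simp: path_length_def quiver_paths_def awalk_Nil_iff)
  qed
  then show ?thesis using assms(1) by (simp add: pfilt_def)
qed

text \<open>If \<open>x\<close> were outside the maximal \<open>K\<close>, then
  \<open>K + A x\<close> would be everything, so \<open>1 = j + n\<close> with \<open>j\<close> in
  \<open>K\<close> and \<open>n\<close> a left multiple of \<open>x\<close>. Such an
  \<open>n\<close> is nilpotent modulo \<open>I\<close>, so \<open>1 - n\<close> is invertible
  modulo \<open>I\<close> and \<open>K\<close> contains the unit.\<close>

lemma pfilt_1_maximal_left_ideal:
  assumes max: "maximal_left_ideal K A" and x: "x \<in> pfilt G 1"
  shows "residue I x \<in> K"
proof (rule ccontr)
  assume not_in: "residue I x \<notin> K"
  have K: "left_ideal K A" and neq: "K \<noteq> carrier A"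
    using max by (auto simp: maximal_left_ideal_def)
  define L where "L = {x \<in> pcarrier G. residue I x \<in> K}"
  note L = left_ideal_residue_vimage[OF K, folded L_def]
  have L_carr: "L \<subseteq> pcarrier G" by (auto simp: L_def)
  have x_carr: "x \<in> pcarrier G" using x by (simp add: pfilt_def)
  have minus: "- z \<in> L" if "z \<in> L" for z
    using L(4)[of "scale (-1) (pone G)" z] that L_carr pmul_scale_pone[of z "-1"]
    by (metis pcarrier_pone pcarrier_scale scale_minus_one subsetD)
  \<comment> \<open>Its image in \<open>A\<close> is the left ideal generated by \<open>K\<close>
    and the class of \<open>x\<close>.\<close>
  define L' where "L' = {j + pmul a x | j a. j \<in> L \<and> a \<in> pcarrier G}"
  have "left_ideal (residue I ` L') A"
  proof (rule left_ideal_residueI)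
    show "L' \<subseteq> pcarrier G"
      using L_carr x_carr by (auto simp: L'_def intro!: pcarrier_add pcarrier_pmul)
    show "0 \<in> L'"
      using L(2) by (auto simp: L'_def intro!: exI[of _ 0])
  next
    fix a b :: "('a, 'b) path \<Rightarrow>\<^sub>0 'k" assume "a \<in> L'" "b \<in> L'"
    then obtain j c k d where "a = j + pmul c x" "j \<in> L" "c \<in> pcarrier G"
      "b = k + pmul d x" "k \<in> L" "d \<in> pcarrier G" by (auto simp: L'_def)
    then show "a + b \<in> L'"
      unfolding L'_def using L(3) pcarrier_add
      by (intro CollectI exI[of _ "j + k"] exI[of _ "c + d"]) (auto simp: pmul_add_left algebra_simps)
  next
    fix a b :: "('a, 'b) path \<Rightarrow>\<^sub>0 'k" assume a: "a \<in> pcarrier G" and "b \<in> L'"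
    then obtain j c where "b = j + pmul c x" "j \<in> L" "c \<in> pcarrier G" by (auto simp: L'_def)
    then show "pmul a b \<in> L'"
      unfolding L'_def using L(4)[OF a] pcarrier_pmul[OF a]
      by (intro CollectI exI[of _ "pmul a j"] exI[of _ "pmul a c"]) (auto simp: pmul_add_right pmul_assoc)
  qed
  moreover have "K \<subseteq> residue I ` L'"
  proof -
    have "L \<subseteq> L'"
      unfolding L'_def by (intro subsetI CollectI, rule exI, rule exI[of _ 0]) simp
    then show ?thesis unfolding L(1) by blast
  qed
  moreover have "x \<in> L'"
    unfolding L'_def using L(2) x_carr pcarrier_pone
    by (intro CollectI exI[of _ 0] exI[of _ "pone G"]) (simp add: pmul_pone_left)
  ultimately have "residue I ` L' = carrier A"
    using max not_in unfolding maximal_left_ideal_def by blast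
  then have "residue I (pone G) \<in> residue I ` L'"
    using residue_in_carrier[OF pcarrier_pone] by simp
  then obtain j a where j: "j \<in> L" and a: "a \<in> pcarrier G"
    and eq: "residue I (pone G) = residue I (j + pmul a x)" by (auto simp: L'_def)
  define n where "n = pmul a x"
  have n: "n \<in> pfilt G 1" using ideal_pmul_left[OF ideal_pfilt a x] by (simp add: n_def)
  then have n_carr: "n \<in> pcarrier G" by (simp add: pfilt_def)
  \<comment> \<open>\<open>L\<close> is a full preimage, so it contains the kernel of the residue
    map.\<close>
  have I_L: "i \<in> L" if "i \<in> I" for i
  proof -
    have "residue I i = residue I 0"
      using that by (subst residue_eq_iff[OF I_ideal]) (auto intro: I_pcarrier)
    then show ?thesis using L(2) that I_pcarrier by (auto simp: L_def)
  qed
  have "pone G - (j + n) \<in> I"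
    using eq j L_carr n_carr pcarrier_pone
    by (subst residue_eq_iff[OF I_ideal, symmetric]) (auto simp: n_def intro!: pcarrier_add)
  then have "(pone G - (j + n)) + j \<in> L" using I_L j by (intro L(3))
  then have one_n: "pone G - n \<in> L" by (simp add: algebra_simps)
  have diff: "pmul y (z - w) = pmul y z - pmul y w" for y z w :: "('a, 'b) path \<Rightarrow>\<^sub>0 'k"
    using pmul_add_right[of y "z - w" w] by (simp add: algebra_simps)
  \<comment> \<open>The witness is the \<open>t\<close>-th power of \<open>n\<close>: the induction
    uses \<open>1 - y n = (1 - y) + y (1 - n)\<close>, starting from \<open>y = 1\<close>. For
    \<open>t = N\<close> the witness lies in \<open>I\<close>, hence in \<open>L\<close>.\<close>
  have powers: "\<exists>y\<in>pfilt G t. pone G - y \<in> L" for t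
  proof (induction t)
    case 0
    show ?case using L(2) by (intro bexI[of _ "pone G"]) (simp_all add: pcarrier_pone)
  next
    case (Suc t)
    then obtain y where y: "y \<in> pfilt G t" "pone G - y \<in> L" by blast
    then have y_carr: "y \<in> pcarrier G" by (simp add: pfilt_def)
    have "pmul y (pone G - n) \<in> L" using one_n y_carr by (rule L(4)[rotated])
    with y have "(pone G - y) + pmul y (pone G - n) \<in> L" by (intro L(3))
    then have "pone G - pmul y n \<in> L"
      using y_carr by (simp add: diff pmul_pone_right algebra_simps)
    moreover have "pmul y n \<in> pfilt G (Suc t)" using pfilt_pmul[OF y(1) n] by simp
    ultimately show ?case by blast
  qed
  obtain N where "pfilt G N \<subseteq> I" using admissible by (auto simp: admissible_ideal_iff)
  with powers[of N] I_L obtain y where "y \<in> L" "pone G - y \<in> L" by blast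
  then have "(pone G - y) + y \<in> L" by (intro L(3))
  then have one: "pone G \<in> L" by simp
  have "z \<in> L" if "z \<in> pcarrier G" for z
    using L(4)[OF that one] that by (simp add: pmul_pone_right)
  then have "carrier A \<subseteq> K" unfolding L(1) carrier_A by blast
  moreover have "K \<subseteq> carrier A"
    unfolding L(1) carrier_A using L_carr by blast
  ultimately show False using neq by simp
qed

text \<open>The maximal left ideals attached to vertices already cut the radical down to paths of
  positive length; nilpotency of these paths modulo \<open>I\<close> gives the other
  inclusion.\<close>

lemma jacobson_radical_A: "jacobson_radical A = resid_pfilt 1"
proof
  show "jacobson_radical A \<subseteq> resid_pfilt 1"
  proof
    fix a assume a: "a \<in> jacobson_radical A"
    then obtain x where x: "x \<in> pcarrier G" "a = residue I x"
      unfolding jacobson_radical_def carrier_A by blast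
    have "x \<in> vertex_kernel v" if "v \<in> verts G" for v
      using a maximal_left_ideal_vertex_kernel[OF that] residue_vertex_kernel_iff[OF x(1)]
      unfolding jacobson_radical_def x(2) by blast
    then show "a \<in> resid_pfilt 1"
      using pfilt_1_vertex_kernel[OF x(1)] x(2) by (auto simp: resid_pfilt_def)
  qed
  show "resid_pfilt 1 \<subseteq> jacobson_radical A"
    unfolding jacobson_radical_def resid_pfilt_def carrier_A
    using pfilt_1_maximal_left_ideal subsetD[OF pfilt_subset] by blast
qed

text \<open>The residue map is a surjective ring homomorphism, so it carries products of ideals to
  products of ideals.\<close>

lemma rad_power_A: "rad_power A t = resid_pfilt t"
proof (induction t)
  case 0
  then show ?case by (simp add: resid_pfilt_def a_rcosets_residue[OF I_ideal])
next
  case (Suc t)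
  let ?P = "ideal_prod (path_algebra G) (pfilt G 1) (pfilt G t) :: (('a, 'b) path \<Rightarrow>\<^sub>0 'k) set"
  \<comment> \<open>Allows induction over an element of \<open>pfilt G (Suc t)\<close> as a sum of
    products.\<close>
  have P: "?P = pfilt G (Suc t)"
    using ideal_power_pfilt[of "Suc t"] unfolding ideal_power.simps ideal_power_pfilt .
  have "ideal_prod A (resid_pfilt 1) (resid_pfilt t) \<subseteq> resid_pfilt (Suc t)"
  proof
    fix a assume "a \<in> ideal_prod A (resid_pfilt 1) (resid_pfilt t)"
    then show "a \<in> resid_pfilt (Suc t)"
    proof induction
      case (prod a b)
      then obtain x y where xy: "x \<in> pfilt G 1" "y \<in> pfilt G t" "a = residue I x" "b = residue I y"
        by (auto simp: resid_pfilt_def)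
      then have "x \<in> pcarrier G" "y \<in> pcarrier G" by (auto simp: pfilt_def)
      then have "a \<otimes>\<^bsub>A\<^esub> b = residue I (pmul x y)"
        unfolding xy by (rule A_mult)
      then show ?case
        using pfilt_pmul[OF xy(1,2)] by (auto simp: resid_pfilt_def)
    next
      case (sum a b)
      then show ?case
        using additive_subgroup.a_closed[OF ideal.axioms(1)[OF ideal_resid_pfilt]] by blast
    qed
  qed
  moreover have "residue I x \<in> ideal_prod A (resid_pfilt 1) (resid_pfilt t)" if "x \<in> ?P" for x
    using that
  proof induction
    case (prod x y)
    then have "residue I x \<otimes>\<^bsub>A\<^esub> residue I y = residue I (x \<otimes>\<^bsub>path_algebra G\<^esub> y)"
      using subsetD[OF pfilt_subset] by (subst A_mult) auto
    moreover have "residue I x \<otimes>\<^bsub>A\<^esub> residue I y \<in> ideal_prod A (resid_pfilt 1) (resid_pfilt t)"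
      using prod by (intro ideal_prod.prod) (auto simp: resid_pfilt_def)
    ultimately show ?case by simp
  next
    case (sum x y)
    have "x \<in> pcarrier G" "y \<in> pcarrier G"
      using sum.hyps P by (auto simp: pfilt_def)
    then have "residue I x \<oplus>\<^bsub>A\<^esub> residue I y = residue I (x \<oplus>\<^bsub>path_algebra G\<^esub> y)"
      by (subst A_add) auto
    then show ?case
      using ideal_prod.sum[OF sum.IH] by simp
  qed
  then have "resid_pfilt (Suc t) \<subseteq> ideal_prod A (resid_pfilt 1) (resid_pfilt t)"
    unfolding P by (auto simp: resid_pfilt_def)
  ultimately show ?case
    using Suc by (simp add: jacobson_radical_A)
qed

section \<open>The associated graded algebra\<close>

text \<open>Defined for all \<open>x\<close>, although it is an element of degree \<open>t\<close>
  of the graded algebra only for suitable \<open>x\<close>, for instance those in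
  \<open>pfilt G t\<close>. Additivity can thus be stated without length conditions.\<close>

definition gr_class :: "nat \<Rightarrow> (('a, 'b) path \<Rightarrow>\<^sub>0 'k) \<Rightarrow> (('a, 'b) path \<Rightarrow>\<^sub>0 'k) set set" where
  "gr_class t x = resid_pfilt (Suc t) +>\<^bsub>A\<^esub> residue I x"

definition gr_image :: "(('a, 'b) path \<Rightarrow>\<^sub>0 'k) \<Rightarrow> nat \<Rightarrow> (('a, 'b) path \<Rightarrow>\<^sub>0 'k) set set" where
  "gr_image x = (\<lambda>t. gr_class t (homog t x))"

text \<open>Since the radical power is the image of \<open>pfilt G (Suc t)\<close>, equality means
  that \<open>x - y\<close> lies in \<open>pfilt G (Suc t) + I\<close>. This is the origin of the
  kernel condition in \<open>associated_graded_isomorphic\<close>.\<close>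

lemma gr_class_eq_iff:
  assumes "x \<in> pcarrier G" "y \<in> pcarrier G"
  shows "gr_class t x = gr_class t y \<longleftrightarrow> (\<exists>f\<in>pfilt G (Suc t). x - y - f \<in> I)"
  using A.quotient_eq_iff_same_a_r_cos[OF ideal_resid_pfilt residue_in_carrier residue_in_carrier, of x y "Suc t"]
    assms residue_in_resid_pfilt_iff[of "x - y"]
  by (simp add: gr_class_def A_minus pcarrier_diff del: quotient_algebra_simps)

lemma gr_class_zero: "gr_class t 0 = resid_pfilt (Suc t)"
proof -
  interpret ideal "resid_pfilt (Suc t)" A by (rule ideal_resid_pfilt)
  show ?thesis
    unfolding gr_class_def A_zero[symmetric]
    by (rule A.a_rcos_zero[OF ideal_resid_pfilt additive_subgroup.zero_closed[OF is_additive_subgroup]])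
qed

lemma gr_class_eqI: "x \<in> pcarrier G \<Longrightarrow> y \<in> pcarrier G \<Longrightarrow> x - y \<in> pfilt G (Suc t) \<Longrightarrow> gr_class t x = gr_class t y"
  using ideal_zero[OF I_ideal] by (subst gr_class_eq_iff) (auto intro!: bexI[of _ "x - y"])

lemma gr_class_add:
  assumes "x \<in> pcarrier G" "y \<in> pcarrier G"
  shows "gr_class t x <+>\<^bsub>A\<^esub> gr_class t y = gr_class t (x + y)"
proof -
  interpret ideal "resid_pfilt (Suc t)" A by (rule ideal_resid_pfilt)
  show ?thesis
    unfolding gr_class_def using a_rcos_sum[OF residue_in_carrier residue_in_carrier] assms
    by (simp only: A_add)
qed

lemma gr_class_smult:
  assumes x: "x \<in> pcarrier G"
  shows "coset_smult A (resid_pfilt (Suc t)) c (gr_class t x) = gr_class t (scale c x)"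
proof -
  have "resid_pfilt (Suc t) +>\<^bsub>A\<^esub> (c \<odot>\<^bsub>A\<^esub> a) = gr_class t (scale c x)" if "a \<in> gr_class t x" for a
  proof -
    obtain b where "b \<in> resid_pfilt (Suc t)" "a = b \<oplus>\<^bsub>A\<^esub> residue I x"
      using \<open>a \<in> gr_class t x\<close> by (auto simp only: gr_class_def a_r_coset_def')
    then obtain f where f: "f \<in> pfilt G (Suc t)" and a: "a = residue I f \<oplus>\<^bsub>A\<^esub> residue I x"
      by (auto simp only: resid_pfilt_def)
    have f_carr: "f \<in> pcarrier G" using f by (simp add: pfilt_def)
    have "c \<odot>\<^bsub>A\<^esub> a = residue I (scale c (f + x))"
      unfolding a A_add[OF f_carr x] by (rule A_smult) (rule pcarrier_add[OF f_carr x])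
    moreover have "gr_class t (scale c (f + x)) = gr_class t (scale c x)"
      using f f_carr x by (intro gr_class_eqI)
        (auto simp: scale_add_right pfilt_scale intro!: pcarrier_add pcarrier_scale)
    ultimately show ?thesis by (simp only: gr_class_def)
  qed
  then have "coset_smult A (resid_pfilt (Suc t)) c (gr_class t x) =
      (\<Union>a\<in>gr_class t x. gr_class t (scale c x))"
    unfolding coset_smult_def by (intro SUP_cong refl)
  also have "\<dots> = gr_class t (scale c x)"
  proof (rule UN_constant_eq)
    interpret ideal "resid_pfilt (Suc t)" A by (rule ideal_resid_pfilt)
    show "residue I x \<in> gr_class t x"
      unfolding gr_class_def by (rule a_rcos_self[OF residue_in_carrier[OF x]])
  qed simp
  finally show ?thesis .
qed

text \<open>Replacing the factors by \<open>f + x\<close> and \<open>g + y\<close> changes the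
  product by \<open>f (g + y) + x g\<close>, whose paths have length at least
  \<open>i + j + 1\<close>. The cosets in the union defining \<open>rcoset_mult\<close> therefore
  coincide.\<close>

lemma gr_class_mult:
  assumes x: "x \<in> pfilt G i" and y: "y \<in> pfilt G j"
  shows "rcoset_mult A (resid_pfilt (Suc (i + j))) (gr_class i x) (gr_class j y) = gr_class (i + j) (pmul x y)"
proof -
  have carr: "x \<in> pcarrier G" "y \<in> pcarrier G" using x y by (auto simp: pfilt_def)
  have eq: "resid_pfilt (Suc (i + j)) +>\<^bsub>A\<^esub> (a \<otimes>\<^bsub>A\<^esub> b) = gr_class (i + j) (pmul x y)"
    if ab: "a \<in> gr_class i x" "b \<in> gr_class j y" for a b
  proof -
    obtain a' b' where "a' \<in> resid_pfilt (Suc i)" "a = a' \<oplus>\<^bsub>A\<^esub> residue I x"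
      "b' \<in> resid_pfilt (Suc j)" "b = b' \<oplus>\<^bsub>A\<^esub> residue I y"
      using ab by (auto simp only: gr_class_def a_r_coset_def')
    then obtain f g where fg: "f \<in> pfilt G (Suc i)" "g \<in> pfilt G (Suc j)"
      and a: "a = residue I f \<oplus>\<^bsub>A\<^esub> residue I x" and b: "b = residue I g \<oplus>\<^bsub>A\<^esub> residue I y"
      by (auto simp only: resid_pfilt_def)
    have fg_carr: "f \<in> pcarrier G" "g \<in> pcarrier G" using fg by (auto simp: pfilt_def)
    have sum_carr: "f + x \<in> pcarrier G" "g + y \<in> pcarrier G"
      using fg_carr carr by (auto intro: pcarrier_add)
    have "a \<otimes>\<^bsub>A\<^esub> b = residue I (pmul (f + x) (g + y))"
      unfolding a b A_add[OF fg_carr(1) carr(1)] A_add[OF fg_carr(2) carr(2)] by (rule A_mult[OF sum_carr])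
    moreover have "gr_class (i + j) (pmul (f + x) (g + y)) = gr_class (i + j) (pmul x y)"
    proof (rule gr_class_eqI)
      have "pmul f (g + y) \<in> pfilt G (Suc (i + j))"
        using pfilt_pmul[OF fg(1) pfilt_add[OF subsetD[OF pfilt_antimono fg(2)] y]] by simp
      moreover have "pmul x g \<in> pfilt G (Suc (i + j))"
        using pfilt_pmul[OF x fg(2)] by simp
      moreover have "pmul (f + x) (g + y) - pmul x y = pmul f (g + y) + pmul x g"
        by (simp add: pmul_add_left pmul_add_right)
      ultimately show "pmul (f + x) (g + y) - pmul x y \<in> pfilt G (Suc (i + j))"
        by (simp only: pfilt_add)
    qed (use sum_carr carr in \<open>auto intro: pcarrier_pmul\<close>)
    ultimately show ?thesis by (simp only: gr_class_def)
  qed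
  \<comment> \<open>The constant unions below collapse only over nonempty index sets.\<close>
  have ne: "residue I x \<in> gr_class i x" "residue I y \<in> gr_class j y"
  proof -
    interpret i: ideal "resid_pfilt (Suc i)" A by (rule ideal_resid_pfilt)
    interpret j: ideal "resid_pfilt (Suc j)" A by (rule ideal_resid_pfilt)
    show "residue I x \<in> gr_class i x" "residue I y \<in> gr_class j y"
      unfolding gr_class_def
      by (rule i.a_rcos_self[OF residue_in_carrier[OF carr(1)]] j.a_rcos_self[OF residue_in_carrier[OF carr(2)]])+
  qed
  have "rcoset_mult A (resid_pfilt (Suc (i + j))) (gr_class i x) (gr_class j y) =
      (\<Union>a\<in>gr_class i x. \<Union>b\<in>gr_class j y. gr_class (i + j) (pmul x y))"
    unfolding rcoset_mult_def using eq by (intro SUP_cong refl)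
  also have "\<dots> = (\<Union>a\<in>gr_class i x. gr_class (i + j) (pmul x y))"
    by (intro SUP_cong refl) (rule UN_constant_eq[OF ne(2)], blast)
  also have "\<dots> = gr_class (i + j) (pmul x y)"
    by (rule UN_constant_eq[OF ne(1)]) blast
  finally show ?thesis .
qed

lemma gr_class_in_Quot:
  assumes "x \<in> pcarrier G"
  shows "gr_class t x \<in> carrier (A Quot resid_pfilt (Suc t))"
proof -
  interpret ideal "resid_pfilt (Suc t)" A by (rule ideal_resid_pfilt)
  show ?thesis
    unfolding gr_class_def FactRing_def
    using A.a_rcosetsI[OF a_subset residue_in_carrier[OF assms]] by simp
qed

text \<open>Moves the sum over degrees in the product of \<open>associated_graded\<close> from a
  factor ring back to the path algebra.\<close>

lemma gr_class_finsum:
  assumes "finite F" "\<And>i. i \<in> F \<Longrightarrow> f i \<in> pcarrier G"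
  shows "finsum (A Quot resid_pfilt (Suc t)) (\<lambda>i. gr_class t (f i)) F = gr_class t (sum f F)"
proof -
  interpret ideal "resid_pfilt (Suc t)" A by (rule ideal_resid_pfilt)
  interpret Q: ring "A Quot resid_pfilt (Suc t)" by (rule quotient_is_ring)
  have add: "add (A Quot resid_pfilt (Suc t)) = set_add A" and zero: "zero (A Quot resid_pfilt (Suc t)) = gr_class t 0"
    by (simp_all add: FactRing_def gr_class_zero)
  show ?thesis
    using assms
  proof (induction F)
    case empty
    then show ?case unfolding Q.finsum_empty by (simp only: zero sum.empty)
  next
    case (insert i F)
    have "finsum (A Quot resid_pfilt (Suc t)) (\<lambda>i. gr_class t (f i)) (insert i F) =
        gr_class t (f i) \<oplus>\<^bsub>A Quot resid_pfilt (Suc t)\<^esub>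
        finsum (A Quot resid_pfilt (Suc t)) (\<lambda>i. gr_class t (f i)) F"
      using insert.hyps insert.prems gr_class_in_Quot by (intro Q.finsum_insert) auto
    also have "\<dots> = gr_class t (f i) <+>\<^bsub>A\<^esub> gr_class t (sum f F)"
      using insert by (simp only: add insert_iff simp_thms)
    also have "\<dots> = gr_class t (f i + sum f F)"
      using insert.prems by (intro gr_class_add pcarrier_sum) auto
    also have "f i + sum f F = sum f (insert i F)"
      using insert.hyps by simp
    finally show ?case .
  qed
qed

lemma associated_graded_simps:
  "carrier (associated_graded A) = {X. (\<forall>t. \<exists>x\<in>pfilt G t. X t = gr_class t x) \<and> finite {t. X t \<noteq> gr_class t 0}}"
  "mult (associated_graded A) = (\<lambda>X Y t. finsum (A Quot resid_pfilt (Suc t))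
     (\<lambda>i. rcoset_mult A (resid_pfilt (Suc t)) (X i) (Y (t - i))) {..t})"
  "one (associated_graded A) = (\<lambda>t. if t = 0 then gr_class 0 (pone G) else gr_class t 0)"
  "add (associated_graded A) = (\<lambda>X Y t. X t <+>\<^bsub>A\<^esub> Y t)"
  "module.smult (associated_graded A) = (\<lambda>c X t. coset_smult A (resid_pfilt (Suc t)) c (X t))"
proof -
  have "(\<exists>a\<in>resid_pfilt t. X = resid_pfilt (Suc t) +>\<^bsub>A\<^esub> a) \<longleftrightarrow> (\<exists>x\<in>pfilt G t. X = gr_class t x)" for t X
    unfolding resid_pfilt_def[of t] gr_class_def by blast
  then show "carrier (associated_graded A) =
      {X. (\<forall>t. \<exists>x\<in>pfilt G t. X t = gr_class t x) \<and> finite {t. X t \<noteq> gr_class t 0}}"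
    by (simp only: associated_graded_def partial_object.select_convs rad_power_A gr_class_zero)
  show "one (associated_graded A) = (\<lambda>t. if t = 0 then gr_class 0 (pone G) else gr_class t 0)"
    unfolding gr_class_zero
    by (simp only: associated_graded_def monoid.select_convs rad_power_A gr_class_def A_one One_nat_def)
qed (simp_all only: associated_graded_def partial_object.select_convs monoid.select_convs
    ring.select_convs module.select_convs rad_power_A)

lemma homog_pcarrier: "x \<in> pcarrier G \<Longrightarrow> homog t x \<in> pcarrier G"
  by (simp add: homog_def pcarrier_restrict_keys)

lemma gr_image_carrier:
  "x \<in> pcarrier G \<Longrightarrow> gr_image x \<in> carrier (associated_graded A)"
  unfolding associated_graded_simps gr_image_def
proof (intro CollectI conjI allI)
  fix t assume "x \<in> pcarrier G"
  then show "\<exists>y\<in>pfilt G t. gr_class t (homog t x) = gr_class t y"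
    by (intro bexI[of _ "homog t x"] homog_in_pfilt) auto
next
  have "homog t x = 0" if "t \<notin> path_length ` Poly_Mapping.keys x" for t
    using that by (intro poly_mapping_eqI) (auto simp: in_keys_iff image_iff)
  then have "{t. gr_class t (homog t x) \<noteq> gr_class t 0} \<subseteq> path_length ` Poly_Mapping.keys x"
    by auto
  then show "finite {t. gr_class t (homog t x) \<noteq> gr_class t 0}"
    by (rule finite_subset) simp
qed

text \<open>A preimage collects the degree \<open>t\<close> parts of representatives; the finite
  support of \<open>X\<close> makes this a finite sum.\<close>

lemma gr_image_surj:
  assumes "X \<in> carrier (associated_graded A)"
  shows "X \<in> gr_image ` pcarrier G"
proof -
  have X: "\<forall>t. \<exists>x\<in>pfilt G t. X t = gr_class t x" "finite {t. X t \<noteq> gr_class t 0}"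
    using assms unfolding associated_graded_simps by blast+
  from X(1) obtain y where y: "\<And>t. y t \<in> pfilt G t" "\<And>t. X t = gr_class t (y t)" by metis
  then have y_carr: "\<And>t. y t \<in> pcarrier G" by (auto simp: pfilt_def)
  define F where "F = {t. X t \<noteq> gr_class t 0}"
  define x where "x = (\<Sum>t\<in>F. homog t (y t))"
  have "finite F" using X(2) by (simp add: F_def)
  have "x \<in> pcarrier G"
    unfolding x_def using y_carr by (intro pcarrier_sum homog_pcarrier)
  moreover have "gr_image x = X"
  proof
    fix t
    have homog_homog: "homog s (homog t (y t)) = (if s = t then homog t (y t) else 0)" for s t
      by (rule poly_mapping_eqI) auto
    have homog_x: "homog t x = (if t \<in> F then homog t (y t) else 0)"
      using \<open>finite F\<close> by (simp add: x_def homog_sum homog_homog if_distrib cong: if_cong)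
    \<comment> \<open>Passing to the homogeneous part drops only paths longer than \<open>t\<close>,
      which vanish in degree \<open>t\<close>.\<close>
    have "gr_class t (y t) = gr_class t (homog t (y t))"
      using y(1) y_carr by (intro gr_class_eqI homog_pcarrier pfilt_Suc_diff_homog)
    then show "gr_image x t = X t"
      using y(2) by (cases "t \<in> F") (simp_all add: gr_image_def homog_x F_def)
  qed
  ultimately show ?thesis by blast
qed

lemma gr_image_mult:
  assumes "x \<in> pcarrier G" "y \<in> pcarrier G"
  shows "gr_image x \<otimes>\<^bsub>associated_graded A\<^esub> gr_image y = gr_image (pmul x y)"
proof
  fix t
  have "rcoset_mult A (resid_pfilt (Suc t)) (gr_image x i) (gr_image y (t - i)) =
      gr_class t (pmul (homog i x) (homog (t - i) y))" if "i \<le> t" for i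
    using gr_class_mult[OF homog_in_pfilt homog_in_pfilt, OF assms, of i "t - i"] that
    by (simp add: gr_image_def)
  moreover have "gr_class t (pmul (homog i x) (homog (t - i) y)) \<in> carrier (A Quot resid_pfilt (Suc t))" for i
    using assms by (intro gr_class_in_Quot pcarrier_pmul homog_pcarrier)
  ultimately have "(gr_image x \<otimes>\<^bsub>associated_graded A\<^esub> gr_image y) t =
      finsum (A Quot resid_pfilt (Suc t)) (\<lambda>i. gr_class t (pmul (homog i x) (homog (t - i) y))) {..t}"
    unfolding associated_graded_simps
    by (intro abelian_monoid.finsum_cong' ring.is_abelian_group ideal.quotient_is_ring
        ideal_resid_pfilt abelian_group.axioms(1)) auto
  also have "\<dots> = gr_class t (\<Sum>i\<le>t. pmul (homog i x) (homog (t - i) y))"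
    using assms by (intro gr_class_finsum pcarrier_pmul homog_pcarrier) auto
  also have "\<dots> = gr_image (pmul x y) t"
    by (simp add: gr_image_def homog_pmul)
  finally show "(gr_image x \<otimes>\<^bsub>associated_graded A\<^esub> gr_image y) t = gr_image (pmul x y) t" .
qed

lemma gr_image_add:
  "x \<in> pcarrier G \<Longrightarrow> y \<in> pcarrier G \<Longrightarrow>
    gr_image x \<oplus>\<^bsub>associated_graded A\<^esub> gr_image y = gr_image (x + y)"
  unfolding associated_graded_simps
  by (simp only: gr_image_def gr_class_add homog_pcarrier homog_add)

lemma gr_image_smult:
  "x \<in> pcarrier G \<Longrightarrow> c \<odot>\<^bsub>associated_graded A\<^esub> gr_image x = gr_image (scale c x)"
  unfolding associated_graded_simps
  by (simp only: gr_image_def gr_class_smult homog_pcarrier homog_scale)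

lemma gr_image_one: "\<one>\<^bsub>associated_graded A\<^esub> = gr_image (pone G)"
proof
  fix t
  have "homog t (pone G) = (if t = 0 then pone G else 0 :: ('a, 'b) path \<Rightarrow>\<^sub>0 'k)"
    unfolding pone_def homog_sum by (auto simp: homog_single path_length_def intro!: sum.neutral)
  then show "\<one>\<^bsub>associated_graded A\<^esub> t = gr_image (pone G) t"
    by (simp only: associated_graded_simps gr_image_def) simp
qed

text \<open>\<open>gr_image\<close> is an epimorphism, and \<open>ker\<close> says that
  \<open>J\<close> is its kernel: every homogeneous component of \<open>x\<close> must vanish in its
  degree.\<close>

theorem associated_graded_isomorphic:
  assumes J: "ideal J (path_algebra G)"
    and ker: "\<And>x. x \<in> pcarrier G \<Longrightarrow> x \<in> J \<longleftrightarrow> (\<forall>t. \<exists>f\<in>pfilt G (Suc t). homog t x - f \<in> I)"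
  shows "algebra_isomorphic (associated_graded A) (quotient_algebra (path_algebra G) J)"
proof -
  let ?gr = "associated_graded A" and ?Q = "quotient_algebra (path_algebra G) J"
  have homog_diff: "homog t (x - y) = homog t x - homog t y" for t and x y :: "('a, 'b) path \<Rightarrow>\<^sub>0 'k"
    by (rule poly_mapping_eqI) (simp add: lookup_minus)
  have gr_image_eq_iff: "gr_image x = gr_image y \<longleftrightarrow> x - y \<in> J"
    if "x \<in> pcarrier G" "y \<in> pcarrier G" for x y
    using that by (simp add: gr_image_def fun_eq_iff gr_class_eq_iff homog_pcarrier ker pcarrier_diff homog_diff)
  \<comment> \<open>The inverse of the induced isomorphism: a fibre of \<open>gr_image\<close> is a
    coset of \<open>J\<close>, so no representatives need to be chosen.\<close>
  define \<phi> where "\<phi> X = {x \<in> pcarrier G. gr_image x = X}" for X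
  have \<phi>: "\<phi> (gr_image x) = residue J x" if "x \<in> pcarrier G" for x
  proof (rule Set.set_eqI)
    fix y
    have "y \<in> pcarrier G" if "y \<in> residue J x"
      using that \<open>x \<in> pcarrier G\<close> ideal_subset_pcarrier[OF J] by (auto simp: residue_def' intro!: pcarrier_add)
    then show "y \<in> \<phi> (gr_image x) \<longleftrightarrow> y \<in> residue J x"
      using that by (auto simp: \<phi>_def gr_image_eq_iff mem_residue_iff[OF J])
  qed
  have carr: "carrier ?gr = gr_image ` pcarrier G"
    using gr_image_carrier gr_image_surj by blast
  have carr_Q: "carrier ?Q = residue J ` pcarrier G"
    by (simp add: a_rcosets_residue[OF J])
  have "\<phi> \<in> Ring.ring_hom ?gr ?Q"
  proof (rule ring_hom_memI)
    fix X Y assume "X \<in> carrier ?gr" "Y \<in> carrier ?gr"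
    then obtain x y where xy: "x \<in> pcarrier G" "y \<in> pcarrier G" "X = gr_image x" "Y = gr_image y"
      unfolding carr by blast
    show "\<phi> X \<in> carrier ?Q"
      unfolding carr_Q xy(3) using xy \<phi> by blast
    show "\<phi> (X \<otimes>\<^bsub>?gr\<^esub> Y) = \<phi> X \<otimes>\<^bsub>?Q\<^esub> \<phi> Y"
      unfolding xy(3,4) gr_image_mult[OF xy(1,2)]
      using xy by (simp add: \<phi> pcarrier_pmul residue_mult[OF J])
    show "\<phi> (X \<oplus>\<^bsub>?gr\<^esub> Y) = \<phi> X \<oplus>\<^bsub>?Q\<^esub> \<phi> Y"
      unfolding xy(3,4) gr_image_add[OF xy(1,2)]
      using xy by (simp add: \<phi> pcarrier_add residue_add[OF J])
  next
    show "\<phi> \<one>\<^bsub>?gr\<^esub> = \<one>\<^bsub>?Q\<^esub>"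
      unfolding gr_image_one by (simp add: \<phi> pcarrier_pone)
  qed
  moreover have "bij_betw \<phi> (carrier ?gr) (carrier ?Q)"
  proof (rule bij_betw_imageI)
    show "inj_on \<phi> (carrier ?gr)"
    proof (rule inj_onI)
      fix X Y assume "X \<in> carrier ?gr" "Y \<in> carrier ?gr" "\<phi> X = \<phi> Y"
      then obtain x where "x \<in> pcarrier G" "X = gr_image x" unfolding carr by blast
      then have "x \<in> \<phi> X" by (simp add: \<phi>_def)
      then have "x \<in> \<phi> Y" by (simp only: \<open>\<phi> X = \<phi> Y\<close>)
      then show "X = Y" using \<open>X = gr_image x\<close> by (simp add: \<phi>_def)
    qed
    show "\<phi> ` carrier ?gr = carrier ?Q"
      unfolding carr carr_Q image_image using \<phi> by (intro image_cong refl)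
  qed
  ultimately have "\<phi> \<in> ring_iso ?gr ?Q" by (simp add: ring_iso_def)
  moreover have "\<phi> (c \<odot>\<^bsub>?gr\<^esub> X) = c \<odot>\<^bsub>?Q\<^esub> \<phi> X" if X: "X \<in> carrier ?gr" for c X
  proof -
    obtain x where x: "x \<in> pcarrier G" "X = gr_image x" using X unfolding carr by blast
    then show ?thesis
      by (simp add: gr_image_smult \<phi> pcarrier_scale residue_smult[OF J])
  qed
  ultimately show ?thesis unfolding algebra_isomorphic_def by blast
qed

end

section \<open>The special matrix\<close>

lemma dim_special_step [simp]:
  "dim_row (special_step q C) = dim_row C" "dim_col (special_step q C) = dim_col C"
  by (simp_all add: special_step_def clear_above_def)

text \<open>\<open>P q D\<close> is an invariant of the matrix \<open>D\<close> reached when exactly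
  the columns from \<open>q\<close> on have been treated. The index falls because the procedure runs
  from right to left.\<close>

lemma special_matrix_induct:
  assumes base: "P (dim_col C) C"
    and step: "\<And>q D. q < dim_col C \<Longrightarrow> dim_row D = dim_row C \<Longrightarrow> dim_col D = dim_col C \<Longrightarrow>
      P (Suc q) D \<Longrightarrow> P q (special_step q D)"
  shows "P 0 (special_matrix C)" "dim_row (special_matrix C) = dim_row C"
    "dim_col (special_matrix C) = dim_col C"
proof -
  define D where "D q = fold special_step (rev [q..<dim_col C]) C" for q
  have D_step: "D q = special_step q (D (Suc q))" if "q < dim_col C" for q
    using that by (simp add: D_def upt_conv_Cons)
  have "P q (D q) \<and> dim_row (D q) = dim_row C \<and> dim_col (D q) = dim_col C" if "q \<le> dim_col C" for q
    using that
  proof (induction rule: inc_induct)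
    case base
    then show ?case using assms(1) by (simp add: D_def)
  next
    case (step q)
    then show ?case using assms(2)[of q "D (Suc q)"] by (simp add: D_step)
  qed
  from this[of 0] show "P 0 (special_matrix C)" "dim_row (special_matrix C) = dim_row C"
    "dim_col (special_matrix C) = dim_col C"
    by (simp_all add: D_def special_matrix_def)
qed

lemma finite_candidate_rows: "finite (candidate_rows C q)"
  by (simp add: candidate_rows_def)

lemma special_step_cases:
  obtains (none) "candidate_rows C q = {}" "special_step q C = C"
  | (pivot) l where "l \<in> candidate_rows C q" "\<And>i. i \<in> candidate_rows C q \<Longrightarrow> i \<le> l"
      "special_step q C = clear_above q l C"
proof (cases "candidate_rows C q = {}")
  case True
  then show ?thesis using none by (simp add: special_step_def)
next
  case False
  then show ?thesis
    using pivot[of "Max (candidate_rows C q)"] finite_candidate_rows[of C q]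
    by (simp add: special_step_def)
qed

lemma clear_above_index:
  "i < dim_row C \<Longrightarrow> j < dim_col C \<Longrightarrow> clear_above q l C $$ (i, j) =
     (if i < l then C $$ (i, j) - C $$ (i, q) / C $$ (l, q) * C $$ (l, j) else C $$ (i, j))"
  by (simp add: clear_above_def)

text \<open>A row \<open>i\<close> changes only by multiples of a lower row \<open>l\<close>, which
  starts at \<open>f l > f i\<close>, so the columns up to \<open>f i\<close> stay untouched. The
  surviving leading ones keep all rows nonzero and give the required first coefficient 1.\<close>

lemma special_matrix_pivots:
  fixes C :: "'k::field_char_0 mat"
  assumes f: "\<And>i. i < dim_row C \<Longrightarrow> f i < dim_col C"
      "\<And>i i'. i < i' \<Longrightarrow> i' < dim_row C \<Longrightarrow> f i < f i'"
    and C: "\<And>i. i < dim_row C \<Longrightarrow> C $$ (i, f i) = 1 \<and> (\<forall>j<f i. C $$ (i, j) = 0)"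
    and i: "i < dim_row C"
  shows "special_matrix C $$ (i, f i) = 1 \<and> (\<forall>j<f i. special_matrix C $$ (i, j) = 0)"
proof -
  let ?P = "\<lambda>_ D. \<forall>i<dim_row C. D $$ (i, f i) = 1 \<and> (\<forall>j<f i. D $$ (i, j) = 0)"
  have "?P 0 (special_matrix C)"
  proof (rule special_matrix_induct(1)[where P = ?P])
    show "?P (dim_col C) C" using C by blast
    fix q and D :: "'k mat"
    assume q: "q < dim_col C" and dims: "dim_row D = dim_row C" "dim_col D = dim_col C"
      and D: "?P (Suc q) D"
    show "?P q (special_step q D)"
    proof (cases rule: special_step_cases[of D q])
      case (pivot l)
      then have l: "l < dim_row C" by (simp add: candidate_rows_def dims)
      have eq: "special_step q D $$ (i, j) = D $$ (i, j)" if "i < dim_row C" "j \<le> f i" for i j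
      proof -
        have "j < dim_col C" using that f(1)[of i] by simp
        moreover have "D $$ (l, j) = 0" if "i < l"
          using that \<open>j \<le> f i\<close> f(2)[OF that l] D l by auto
        ultimately show ?thesis
          using that dims by (simp add: pivot clear_above_index)
      qed
      show ?thesis
        using D by (simp add: eq)
    qed (use D in simp)
  qed
  then show ?thesis using i by blast
qed

text \<open>A row is a candidate in column \<open>q\<close> exactly when \<open>q\<close> is its
  last nonzero column, so distinct rows end in distinct columns. Treating column \<open>p\<close>
  leaves a single candidate there, and columns to its right do not change because the subtracted row
  is zero in them.\<close>

lemma special_matrix_candidate_rows:
  fixes C :: "'k::field_char_0 mat"
  assumes "q < dim_col C"
    and "i \<in> candidate_rows (special_matrix C) q" "i' \<in> candidate_rows (special_matrix C) q"
  shows "i = i'"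
proof -
  let ?P = "\<lambda>p D. \<forall>q i i'. p \<le> q \<longrightarrow> q < dim_col C \<longrightarrow> i \<in> candidate_rows D q \<longrightarrow>
    i' \<in> candidate_rows D q \<longrightarrow> i = i'"
  have "?P 0 (special_matrix C)"
  proof (rule special_matrix_induct(1)[where P = ?P])
    fix p and D :: "'k mat"
    assume p: "p < dim_col C" and dims: "dim_row D = dim_row C" "dim_col D = dim_col C"
      and D: "?P (Suc p) D"
    show "?P p (special_step p D)"
    proof (cases rule: special_step_cases[of D p])
      case none
      have "?P p D"
      proof (intro allI impI)
        fix q i i' assume "p \<le> q" "q < dim_col C" "i \<in> candidate_rows D q" "i' \<in> candidate_rows D q"
        then have "Suc p \<le> q" using none(1) by (cases "p = q") auto
        then show "i = i'" using D \<open>q < dim_col C\<close> \<open>i \<in> _\<close> \<open>i' \<in> _\<close> by blast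
      qed
      then show ?thesis by (simp add: none)
    next
      case (pivot l)
      then have l: "l < dim_row D" "D $$ (l, p) \<noteq> 0"
        "\<And>j. p < j \<Longrightarrow> j < dim_col D \<Longrightarrow> D $$ (l, j) = 0"
        by (simp_all add: candidate_rows_def)
      let ?E = "special_step p D"
      have same: "?E $$ (i, j) = D $$ (i, j)" if "i < dim_row D" "j < dim_col D" "p < j \<or> \<not> i < l" for i j
        using that l(3)[of j] by (auto simp: pivot clear_above_index)
      have zero: "?E $$ (i, p) = 0" if "i < l" for i
        using that l p dims by (simp add: pivot clear_above_index)
      show ?thesis
      proof (intro allI impI)
        fix q i i'
        assume q: "p \<le> q" "q < dim_col C" and i: "i \<in> candidate_rows ?E q" "i' \<in> candidate_rows ?E q"
        show "i = i'"
        proof (cases "p = q")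
          case False
          then have "candidate_rows ?E q = candidate_rows D q"
            using q dims by (auto simp: candidate_rows_def same)
          moreover have "Suc p \<le> q" using q False by simp
          ultimately show ?thesis using D q i by blast
        next
          case True
          \<comment> \<open>Rows above \<open>l\<close> have been cleared in column
            \<open>p\<close>; rows below \<open>l\<close> are unchanged and would have been
            candidates lower than the bottom-most one.\<close>
          have "k = l" if k: "k \<in> candidate_rows ?E p" for k
          proof -
            have nl: "\<not> k < l" using zero k by (auto simp: candidate_rows_def)
            then have "k \<in> candidate_rows D p"
              using k p dims same[of k] by (auto simp: candidate_rows_def)
            then show ?thesis using pivot(2) nl by force
          qed
          then show ?thesis using i True by blast
        qed
      qed
    qed
  qed simp
  then show ?thesis using assms by blast
qed

lemma row_relation_clear_above:
  assumes "i < dim_row C"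
  shows "row_relation \<gamma> (clear_above q l C) i =
    row_relation \<gamma> C i - (if i < l then scale (C $$ (i, q) / C $$ (l, q)) (row_relation \<gamma> C l) else 0)"
proof -
  have "row_relation \<gamma> (clear_above q l C) i = (\<Sum>j<dim_col C. Poly_Mapping.single (\<gamma> j) (C $$ (i, j)) -
      (if i < l then scale (C $$ (i, q) / C $$ (l, q)) (Poly_Mapping.single (\<gamma> j) (C $$ (l, j))) else 0))"
    unfolding row_relation_def using assms
    by (intro sum.cong) (auto simp: clear_above_index single_diff clear_above_def)
  then show ?thesis
    by (simp add: sum_subtractf row_relation_def scale_sum)
qed

text \<open>Row \<open>l\<close> itself survives each step, so the subtraction of its multiples can
  be undone and the generated ideal stays the same.\<close>

lemma (in fin_digraph) genideal_special_matrix: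
  fixes C :: "'k::field_char_0 mat"
  assumes \<gamma>: "\<gamma> ` {..<dim_col C} \<subseteq> quiver_paths G" and M: "M \<subseteq> quiver_paths G"
  shows "Idl\<^bsub>path_algebra G\<^esub> (monomials M \<union> row_relation \<gamma> (special_matrix C) ` {..<dim_row C}) =
    Idl\<^bsub>path_algebra G\<^esub> (monomials M \<union> row_relation \<gamma> C ` {..<dim_row C})"
proof -
  let ?gens = "\<lambda>D :: 'k mat. monomials M \<union> row_relation \<gamma> D ` {..<dim_row C}"
  have carr: "?gens D \<subseteq> pcarrier G" if "dim_col D = dim_col C" for D
    using \<gamma> M that
    by (auto simp: row_relation_def monomials_def intro!: pcarrier_sum pcarrier_single)
  show ?thesis
  proof (rule special_matrix_induct(1)[where P = "\<lambda>_ D. Idl\<^bsub>path_algebra G\<^esub> ?gens D = Idl\<^bsub>path_algebra G\<^esub> ?gens C"])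
    fix q and D :: "'k mat"
    assume dims: "dim_row D = dim_row C" "dim_col D = dim_col C"
      and D: "Idl\<^bsub>path_algebra G\<^esub> ?gens D = Idl\<^bsub>path_algebra G\<^esub> ?gens C"
    have "Idl\<^bsub>path_algebra G\<^esub> ?gens (special_step q D) = Idl\<^bsub>path_algebra G\<^esub> ?gens D"
    proof (cases rule: special_step_cases[of D q])
      case (pivot l)
      let ?E = "special_step q D"
      have l: "l < dim_row C" using pivot(1) dims by (simp add: candidate_rows_def)
      have E: "row_relation \<gamma> ?E i = row_relation \<gamma> D i -
          (if i < l then scale (D $$ (i, q) / D $$ (l, q)) (row_relation \<gamma> D l) else 0)"
        if "i < dim_row C" for i
        using that dims by (simp only: pivot row_relation_clear_above)
      have El: "row_relation \<gamma> ?E l = row_relation \<gamma> D l"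
        using E[OF l] by simp
      have carrE: "?gens ?E \<subseteq> pcarrier G" and carrD: "?gens D \<subseteq> pcarrier G"
        by (rule carr, simp add: dims)+
      note ID = genideal_is_ideal[OF carrD] and IE = genideal_is_ideal[OF carrE]
      have gD: "row_relation \<gamma> D i \<in> Idl\<^bsub>path_algebra G\<^esub> ?gens D" if "i < dim_row C" for i
        using genideal_superset[of "?gens D"] that by auto
      have gE: "row_relation \<gamma> ?E i \<in> Idl\<^bsub>path_algebra G\<^esub> ?gens ?E" if "i < dim_row C" for i
        using genideal_superset[of "?gens ?E"] that by auto
      have E_in: "row_relation \<gamma> ?E i \<in> Idl\<^bsub>path_algebra G\<^esub> ?gens D" if "i < dim_row C" for i
        unfolding E[OF that] using that l
        by (intro ideal_diff[OF ID] gD) (auto intro: ideal_scale[OF ID] ideal_zero[OF ID] gD)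
      have D_in: "row_relation \<gamma> D i \<in> Idl\<^bsub>path_algebra G\<^esub> ?gens ?E" if "i < dim_row C" for i
      proof -
        have "row_relation \<gamma> D i = row_relation \<gamma> ?E i +
            (if i < l then scale (D $$ (i, q) / D $$ (l, q)) (row_relation \<gamma> ?E l) else 0)"
          using E[OF that] El by simp
        also have "\<dots> \<in> Idl\<^bsub>path_algebra G\<^esub> ?gens ?E"
          using that l by (intro ideal_add[OF IE] gE) (auto intro: ideal_scale[OF IE] ideal_zero[OF IE] gE)
        finally show ?thesis .
      qed
      show ?thesis
        by (rule genideal_eqI[OF carrE carrD])
          (use genideal_superset[of "?gens D"] genideal_superset[of "?gens ?E"] E_in D_in in auto)
    qed simp
    then show "Idl\<^bsub>path_algebra G\<^esub> ?gens (special_step q D) = Idl\<^bsub>path_algebra G\<^esub> ?gens C"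
      using D by simp
  qed simp
qed

section \<open>Shortest parts\<close>

text \<open>The order of \<open>x\<close> in the length filtration, so
  \<open>homog (min_length x) x\<close> is its initial form. For \<open>x = 0\<close> the minimum is
  unspecified, but every homogeneous part is then 0.\<close>

definition min_length :: "(('v, 'e) path \<Rightarrow>\<^sub>0 'k::field_char_0) \<Rightarrow> nat" where
  "min_length x = Min (path_length ` Poly_Mapping.keys x)"

lemma min_length_eqI:
  assumes "p \<in> Poly_Mapping.keys x" "\<And>q. q \<in> Poly_Mapping.keys x \<Longrightarrow> path_length p \<le> path_length q"
  shows "min_length x = path_length p"
  unfolding min_length_def using assms by (intro Min_eqI) auto

lemma lookup_sum_single_inj:
  assumes "inj_on \<beta> F" "i \<in> F" "finite F"
  shows "Poly_Mapping.lookup (\<Sum>j\<in>F. Poly_Mapping.single (\<beta> j) (c j)) (\<beta> i) = c i"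
proof -
  have "Poly_Mapping.lookup (\<Sum>j\<in>F. Poly_Mapping.single (\<beta> j) (c j)) (\<beta> i) = (\<Sum>j\<in>F. if j = i then c j else 0)"
    unfolding lookup_sum using assms
    by (intro sum.cong) (auto simp: lookup_single when_def inj_on_def)
  then show ?thesis using assms by simp
qed

lemma keys_sum_single_inj:
  assumes "inj_on \<beta> F" "finite F"
  shows "Poly_Mapping.keys (\<Sum>j\<in>F. Poly_Mapping.single (\<beta> j) (c j)) = \<beta> ` {j \<in> F. c j \<noteq> 0}"
proof -
  have "Poly_Mapping.keys (\<Sum>j\<in>F. Poly_Mapping.single (\<beta> j) (c j)) \<subseteq> \<beta> ` F"
    using keys_sum_subset[of "\<lambda>j. Poly_Mapping.single (\<beta> j) (c j)" F] by (auto split: if_splits)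
  then show ?thesis
    using lookup_sum_single_inj[OF assms(1) _ assms(2), of _ c] by (auto simp: in_keys_iff)
qed

lemma ordered_writing_sum:
  assumes "ordered_writing Q \<rho> k \<beta> c"
  shows "\<rho> = (\<Sum>i\<le>k. Poly_Mapping.single (\<beta> i) (c i))"
proof -
  have "{..k} = insert 0 {1..k}" by auto
  then show ?thesis using assms by (simp add: ordered_writing_def)
qed

lemma constant_length_from_last: "constant_length_from k \<beta> k"
  unfolding constant_length_from_def by (metis order.antisym order_refl)

text \<open>Lengths do not increase along a writing, so the indices from \<open>k0\<close> on are
  exactly those of minimal length. The factor is \<open>inverse (c k0)\<close>; up to this scalar
  the shortest part does not depend on the writing.\<close>

lemma shortest_part_eq_homog:
  fixes c :: "nat \<Rightarrow> 'k::field_char_0"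
  assumes w: "ordered_writing Q \<rho> k \<beta> c"
  obtains d where "d \<noteq> 0" "shortest_part k \<beta> c = scale d (homog (min_length \<rho>) \<rho>)"
proof -
  define k0 where "k0 = (LEAST k0. constant_length_from k \<beta> k0)"
  have k0: "constant_length_from k \<beta> k0"
    unfolding k0_def by (rule LeastI) (rule constant_length_from_last)
  have least: "k0 \<le> i" if "constant_length_from k \<beta> i" for i
    unfolding k0_def using that by (rule Least_le)
  have k0_le: "k0 \<le> k" using k0 by (simp add: constant_length_from_def)
  have inj: "inj_on \<beta> {..k}" and c: "\<And>i. i \<le> k \<Longrightarrow> c i \<noteq> 0"
    and mono: "\<And>i j. i \<le> j \<Longrightarrow> j \<le> k \<Longrightarrow> path_length (\<beta> j) \<le> path_length (\<beta> i)"
    using w by (auto simp: ordered_writing_def)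
  note \<rho> = ordered_writing_sum[OF w]
  have "Poly_Mapping.keys \<rho> = \<beta> ` {..k}"
    unfolding \<rho> keys_sum_single_inj[OF inj finite_atMost] using c by auto
  then have min: "min_length \<rho> = path_length (\<beta> k)"
    by (intro min_length_eqI) (auto intro: mono)
  have len: "path_length (\<beta> i) = path_length (\<beta> k) \<longleftrightarrow> k0 \<le> i" if "i \<le> k" for i
  proof
    assume eq: "path_length (\<beta> i) = path_length (\<beta> k)"
    have "constant_length_from k \<beta> i"
      unfolding constant_length_from_def
      using that mono[of i] mono[of _ k] eq by (auto intro: antisym)
    then show "k0 \<le> i" by (rule least)
  next
    assume "k0 \<le> i"
    then show "path_length (\<beta> i) = path_length (\<beta> k)"
      using k0 that unfolding constant_length_from_def by (metis order_refl)
  qed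
  have "homog (min_length \<rho>) \<rho> = (\<Sum>i\<le>k. if k0 \<le> i then Poly_Mapping.single (\<beta> i) (c i) else 0)"
    unfolding min by (subst \<rho>) (auto simp: homog_sum homog_single len intro!: sum.cong)
  also have "\<dots> = (\<Sum>i\<in>{k0..k}. Poly_Mapping.single (\<beta> i) (c i))"
    by (rule sum.mono_neutral_cong_right) auto
  finally have homog: "homog (min_length \<rho>) \<rho> = (\<Sum>i\<in>{k0..k}. Poly_Mapping.single (\<beta> i) (c i))" .
  have "{k0..k} = insert k0 {k0 + 1..k}" using k0_le by auto
  then have "scale (inverse (c k0)) (homog (min_length \<rho>) \<rho>) = shortest_part k \<beta> c"
    using c[OF k0_le]
    by (simp add: homog scale_add_right scale_sum shortest_part_def k0_def[symmetric] Let_def)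
  then show ?thesis using that[of "inverse (c k0)"] c[OF k0_le] by simp
qed

text \<open>The columns are already sorted by length, so the nonzero entries listed in column order
  form a writing. It starts with column \<open>f\<close>, whose entry is 1.\<close>

lemma ordered_writing_combination:
  fixes e :: "nat \<Rightarrow> 'k::field_char_0"
  assumes \<gamma>: "inj_on \<gamma> {..<n}" "\<gamma> ` {..<n} \<subseteq> quiver_paths Q"
    and mono: "\<And>i j. i \<le> j \<Longrightarrow> j < n \<Longrightarrow> path_length (\<gamma> j) \<le> path_length (\<gamma> i)"
    and f: "f < n" "e f = 1" "\<And>j. j < f \<Longrightarrow> e j = 0"
  shows "\<exists>k \<beta> c. ordered_writing Q (\<Sum>j<n. Poly_Mapping.single (\<gamma> j) (e j)) k \<beta> c"
proof -
  define T where "T = {j. j < n \<and> e j \<noteq> 0}"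
  define js where "js = sorted_list_of_set T"
  have "finite T" by (simp add: T_def)
  then have set_js: "set js = T" and sorted: "sorted js" and distinct: "distinct js"
    by (simp_all add: js_def)
  have "f \<in> T" using f by (simp add: T_def)
  then have "js \<noteq> []" using set_js by auto
  define k where "k = length js - 1"
  have k: "i \<le> k \<longleftrightarrow> i < length js" for i
    using \<open>js \<noteq> []\<close> by (cases js) (auto simp: k_def)
  have js_T: "js ! i \<in> T" if "i \<le> k" for i
    using that set_js nth_mem by (auto simp: k)
  have f_le: "f \<le> j" if "j \<in> T" for j
    using that f(3)[of j] by (force simp: T_def)
  have "js ! 0 = f"
  proof (rule antisym)
    obtain i where "i < length js" "js ! i = f"
      using \<open>f \<in> T\<close> set_js by (metis in_set_conv_nth)
    then show "js ! 0 \<le> f" using sorted sorted_nth_mono[of js 0 i] by simp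
    show "f \<le> js ! 0" using f_le js_T[of 0] by simp
  qed
  have "{..k} = {..<length js}" by (auto simp: k)
  then have bij: "bij_betw (\<lambda>i. js ! i) {..k} T"
    by (intro bij_betw_nth distinct) (simp_all only: set_js)
  have "(\<Sum>j<n. Poly_Mapping.single (\<gamma> j) (e j)) = (\<Sum>j\<in>T. Poly_Mapping.single (\<gamma> j) (e j))"
    by (rule sum.mono_neutral_right) (auto simp: T_def)
  also have "\<dots> = (\<Sum>i\<le>k. Poly_Mapping.single (\<gamma> (js ! i)) (e (js ! i)))"
    using sum.reindex_bij_betw[OF bij, of "\<lambda>j. Poly_Mapping.single (\<gamma> j) (e j)"] by simp
  also have "{..k} = insert 0 {1..k}" by auto
  also have "(\<Sum>i\<in>insert 0 {1..k}. Poly_Mapping.single (\<gamma> (js ! i)) (e (js ! i))) =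
      Poly_Mapping.single (\<gamma> (js ! 0)) 1 + (\<Sum>i=1..k. Poly_Mapping.single (\<gamma> (js ! i)) (e (js ! i)))"
    using f \<open>js ! 0 = f\<close> by simp
  finally have sum: "(\<Sum>j<n. Poly_Mapping.single (\<gamma> j) (e j)) =
      Poly_Mapping.single (\<gamma> (js ! 0)) 1 + (\<Sum>i=1..k. Poly_Mapping.single (\<gamma> (js ! i)) (e (js ! i)))" .
  have "inj_on (\<lambda>i. \<gamma> (js ! i)) {..k}"
  proof (rule inj_onI)
    fix i j assume "i \<in> {..k}" "j \<in> {..k}" "\<gamma> (js ! i) = \<gamma> (js ! j)"
    then have "js ! i = js ! j"
      using inj_onD[OF \<gamma>(1)] js_T[of i] js_T[of j] by (auto simp: T_def)
    then show "i = j"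
      using distinct \<open>i \<in> {..k}\<close> \<open>j \<in> {..k}\<close> by (simp add: k nth_eq_iff_index_eq)
  qed
  moreover have "path_length (\<gamma> (js ! j)) \<le> path_length (\<gamma> (js ! i))" if "i \<le> j" "j \<le> k" for i j
    using that sorted js_T[of j] by (intro mono) (auto simp: k T_def intro: sorted_nth_mono)
  ultimately have "ordered_writing Q (\<Sum>j<n. Poly_Mapping.single (\<gamma> j) (e j)) k
      (\<lambda>i. \<gamma> (js ! i)) (\<lambda>i. e (js ! i))"
    unfolding ordered_writing_def using \<gamma>(2) js_T f \<open>js ! 0 = f\<close> sum by (auto simp: T_def)
  then show ?thesis by blast
qed

section \<open>The ideal of shortest parts\<close>

context fin_digraph
begin

text \<open>\<open>independent\<close> excludes cancellation of initial forms: a combination still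
  has a path at least as short as the initial form of each relation used in it. The condition on
  keys keeps the relations apart from \<open>monomial_span G M\<close>.\<close>

context
  fixes \<rho> :: "nat \<Rightarrow> ('a, 'b) path \<Rightarrow>\<^sub>0 'k::field_char_0" and M r v0 \<omega>
  assumes M: "M \<subseteq> quiver_paths G" "\<And>p. p \<in> M \<Longrightarrow> 0 < path_length p"
    and ends: "in_arcs G v0 = {}" "out_arcs G \<omega> = {}"
    and \<rho>: "\<And>i. i < r \<Longrightarrow> Poly_Mapping.keys (\<rho> i) \<subseteq> {b \<in> branches G v0 \<omega>. \<not> contains_monomial M b}"
    and independent: "\<And>d i. i < r \<Longrightarrow> d i \<noteq> 0 \<Longrightarrow>
      \<exists>p\<in>Poly_Mapping.keys (\<Sum>i<r. scale (d i) (\<rho> i)). path_length p \<le> min_length (\<rho> i)"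
begin

abbreviation (input) low :: "nat \<Rightarrow> ('a, 'b) path \<Rightarrow>\<^sub>0 'k" where
  "low i \<equiv> homog (min_length (\<rho> i)) (\<rho> i)"

lemma rho_branches: "i < r \<Longrightarrow> Poly_Mapping.keys (\<rho> i) \<subseteq> branches G v0 \<omega>"
  by (drule \<rho>) blast

lemma rho_pcarrier: "i < r \<Longrightarrow> \<rho> i \<in> pcarrier G"
  using \<rho> by (fastforce simp: pcarrier_def branches_def)

lemma rho_pfilt: "i < r \<Longrightarrow> \<rho> i \<in> pfilt G (min_length (\<rho> i))"
  using rho_pcarrier by (auto simp: pfilt_def min_length_def)

lemma genideal_rho:
  "Idl\<^bsub>path_algebra G\<^esub> (monomials M \<union> \<rho> ` {..<r}) =
    {x + (\<Sum>i<r. scale (d i) (\<rho> i)) | x d. x \<in> monomial_span G M}"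
  by (rule genideal_monomials_branches[OF M ends rho_branches])

lemma genideal_low:
  "Idl\<^bsub>path_algebra G\<^esub> (monomials M \<union> low ` {..<r}) =
    {x + (\<Sum>i<r. scale (d i) (low i)) | x d. x \<in> monomial_span G M}"
  using rho_branches by (intro genideal_monomials_branches[OF M ends]) (auto simp: homog_def)

lemma homog_monomial_span:
  "x \<in> monomial_span G M \<Longrightarrow> homog t x \<in> (monomial_span G M :: (('a, 'b) path \<Rightarrow>\<^sub>0 'k) set)"
  by (auto simp: monomial_span_def homog_def pcarrier_restrict_keys)

text \<open>Identifies the ideal generated by the initial forms with the kernel of
  \<open>gr_image\<close>. One direction completes initial forms to full relations; the other uses
  \<open>independent\<close> to show that no relation of order below \<open>t\<close> contributes in
  degree \<open>t\<close>.\<close>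

lemma genideal_low_iff:
  assumes x: "x \<in> pcarrier G"
  shows "x \<in> Idl\<^bsub>path_algebra G\<^esub> (monomials M \<union> low ` {..<r}) \<longleftrightarrow>
    (\<forall>t. \<exists>f\<in>pfilt G (Suc t). homog t x - f \<in> Idl\<^bsub>path_algebra G\<^esub> (monomials M \<union> \<rho> ` {..<r}))"
proof
  note N = ideal_monomial_span[of M, where 'k = 'k]
  have homog_low: "homog t (low i) = (if t = min_length (\<rho> i) then low i else 0)" for t i
    by (rule poly_mapping_eqI) auto
  show "\<forall>t. \<exists>f\<in>pfilt G (Suc t). homog t x - f \<in> Idl\<^bsub>path_algebra G\<^esub> (monomials M \<union> \<rho> ` {..<r})"
    if "x \<in> Idl\<^bsub>path_algebra G\<^esub> (monomials M \<union> low ` {..<r})"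
  proof
    fix t
    from that obtain u d where x: "x = u + (\<Sum>i<r. scale (d i) (low i))" "u \<in> monomial_span G M"
      unfolding genideal_low by blast
    \<comment> \<open>Only relations of order exactly \<open>t\<close> have their initial form in
      degree \<open>t\<close>.\<close>
    define d' where "d' i = (if t = min_length (\<rho> i) then d i else 0)" for i
    \<comment> \<open>The negated tails of these relations: subtracting \<open>f\<close> turns each
      initial form into the full relation, and the tails are longer than \<open>t\<close>.\<close>
    define f where "f = (\<Sum>i<r. scale (d' i) (- (\<rho> i - low i)))"
    have "f \<in> pfilt G (Suc t)"
      unfolding f_def
    proof (rule pfilt_sum)
      fix i assume "i \<in> {..<r}"
      then have "\<rho> i - low i \<in> pfilt G (Suc (min_length (\<rho> i)))"
        by (intro pfilt_Suc_diff_homog rho_pfilt) simp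
      then have "scale (- d' i) (\<rho> i - low i) \<in> pfilt G (Suc t)"
        by (cases "t = min_length (\<rho> i)") (auto simp: d'_def intro: pfilt_scale)
      moreover have "scale (- d' i) (\<rho> i - low i) = scale (d' i) (- (\<rho> i - low i))"
        by (rule poly_mapping_eqI) (simp add: lookup_minus algebra_simps)
      ultimately show "scale (d' i) (- (\<rho> i - low i)) \<in> pfilt G (Suc t)" by simp
    qed
    moreover have "homog t x - f = homog t u + (\<Sum>i<r. scale (d' i) (\<rho> i))"
    proof -
      have "homog t x = homog t u + (\<Sum>i<r. scale (d' i) (low i))"
        unfolding x homog_add homog_sum homog_scale homog_low
        by (intro arg_cong2[where f = "(+)"] sum.cong refl) (auto simp: d'_def)
      moreover have "scale (d' i) (low i) - scale (d' i) (- (\<rho> i - low i)) = scale (d' i) (\<rho> i)" for i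
        by (rule poly_mapping_eqI) (simp add: lookup_minus algebra_simps)
      ultimately show ?thesis
        unfolding f_def by (simp add: add_diff_eq[symmetric] sum_subtractf[symmetric])
    qed
    moreover have "homog t u \<in> monomial_span G M" using x(2) by (rule homog_monomial_span)
    ultimately show "\<exists>f\<in>pfilt G (Suc t). homog t x - f \<in> Idl\<^bsub>path_algebra G\<^esub> (monomials M \<union> \<rho> ` {..<r})"
      unfolding genideal_rho by blast
  qed
  have low_carr: "monomials M \<union> low ` {..<r} \<subseteq> pcarrier G"
    using M(1) rho_pcarrier by (auto simp: monomials_def homog_def intro!: pcarrier_single pcarrier_restrict_keys)
  note I' = genideal_is_ideal[OF low_carr]
  assume *: "\<forall>t. \<exists>f\<in>pfilt G (Suc t). homog t x - f \<in> Idl\<^bsub>path_algebra G\<^esub> (monomials M \<union> \<rho> ` {..<r})"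
  have "homog t x \<in> Idl\<^bsub>path_algebra G\<^esub> (monomials M \<union> low ` {..<r})" for t
  proof -
    from * obtain f where f: "f \<in> pfilt G (Suc t)"
      and "homog t x - f \<in> Idl\<^bsub>path_algebra G\<^esub> (monomials M \<union> \<rho> ` {..<r})" by blast
    then obtain u d where u: "u \<in> monomial_span G M" and "homog t x - f = u + (\<Sum>i<r. scale (d i) (\<rho> i))"
      unfolding genideal_rho by blast
    define v where "v = (\<Sum>i<r. scale (d i) (\<rho> i))"
    have eq: "homog t x = f + (u + v)"
      using \<open>homog t x - f = _\<close> by (simp add: v_def algebra_simps)
    have v_keys: "\<not> contains_monomial M p" if "p \<in> Poly_Mapping.keys v" for p
    proof -
      obtain i where i: "i < r" "p \<in> Poly_Mapping.keys (scale (d i) (\<rho> i))"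
        using keys_sum_subset[of "\<lambda>i. scale (d i) (\<rho> i)" "{..<r}"] \<open>p \<in> _\<close> by (auto simp: v_def)
      then have "p \<in> Poly_Mapping.keys (\<rho> i)"
        using keys_scale_subset[of "d i" "\<rho> i"] by blast
      then show ?thesis using \<rho>[OF i(1)] by blast
    qed
    \<comment> \<open>A path of \<open>v\<close> shorter than \<open>t\<close> could be cancelled
      neither by \<open>f\<close>, which is longer, nor by \<open>u\<close>, whose paths contain
      monomials; but \<open>homog t x\<close> has no such path.\<close>
    have v_long: "t \<le> path_length p" if p: "p \<in> Poly_Mapping.keys v" for p
    proof (rule ccontr)
      assume short: "\<not> t \<le> path_length p"
      then have "p \<notin> Poly_Mapping.keys f" using f by (auto simp: pfilt_def)
      moreover have "p \<notin> Poly_Mapping.keys u"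
        using v_keys[OF p] u by (auto simp: monomial_span_def)
      moreover have "Poly_Mapping.lookup (homog t x) p = 0" using short by simp
      ultimately have "Poly_Mapping.lookup v p = 0"
        unfolding eq by (simp add: lookup_add in_keys_iff)
      then show False using p by (simp add: in_keys_iff)
    qed
    have d: "t \<le> min_length (\<rho> i)" if "i < r" "d i \<noteq> 0" for i
      using independent[of i d, OF that] v_long unfolding v_def by (meson order_trans)
    have "homog t x = homog t (f + (u + v))"
      unfolding eq[symmetric] by (rule poly_mapping_eqI) simp
    also have "\<dots> = homog t u + homog t v"
      using homog_pfilt[OF f] by (simp add: homog_add)
    \<comment> \<open>Relations used in \<open>v\<close> have order at least \<open>t\<close>, and
      those of larger order have no component of degree \<open>t\<close>.\<close>
    also have "homog t v = (\<Sum>i<r. scale (if t = min_length (\<rho> i) then d i else 0) (low i))"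
      unfolding v_def homog_sum homog_scale
    proof (intro sum.cong refl)
      fix i assume "i \<in> {..<r}"
      then show "scale (d i) (homog t (\<rho> i)) = scale (if t = min_length (\<rho> i) then d i else 0) (low i)"
        using d[of i] homog_pfilt[OF rho_pfilt[of i], of t] by (cases "d i = 0") auto
    qed
    finally show ?thesis
      unfolding genideal_low using homog_monomial_span[OF u, of t]
      by (intro CollectI exI[of _ "homog t u"]
          exI[of _ "\<lambda>i. if t = min_length (\<rho> i) then d i else 0"]) simp
  qed
  \<comment> \<open>All components lie in the ideal, so their sum \<open>x\<close> does. For
    \<open>x = 0\<close> the maximum is unspecified, but the identity with \<open>x\<close> holds
    for any bound.\<close>
  then have "(\<Sum>t<Suc (Max (path_length ` Poly_Mapping.keys x)). homog t x)
      \<in> Idl\<^bsub>path_algebra G\<^esub> (monomials M \<union> low ` {..<r})"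
    by (intro ideal_sum[OF I'])
  moreover have "(\<Sum>t<Suc (Max (path_length ` Poly_Mapping.keys x)). homog t x) = x"
    by (intro sum_homog) (simp add: less_Suc_eq_le)
  ultimately show "x \<in> Idl\<^bsub>path_algebra G\<^esub> (monomials M \<union> low ` {..<r})" by simp
qed

text \<open>Beyond the lengths of all paths in the relations an element of the old ideal has only
  paths containing monomials, and those lie in the new ideal.\<close>

lemma admissible_genideal_low:
  assumes "admissible_ideal G (Idl\<^bsub>path_algebra G\<^esub> (monomials M \<union> \<rho> ` {..<r}))"
  shows "admissible_ideal G (Idl\<^bsub>path_algebra G\<^esub> (monomials M \<union> low ` {..<r}))"
  unfolding admissible_ideal_iff
proof (intro conjI)
  let ?I = "Idl\<^bsub>path_algebra G\<^esub> (monomials M \<union> \<rho> ` {..<r})"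
  let ?I' = "Idl\<^bsub>path_algebra G\<^esub> (monomials M \<union> low ` {..<r})"
  have low_carr: "monomials M \<union> low ` {..<r} \<subseteq> pcarrier G"
    using M(1) rho_pcarrier by (auto simp: monomials_def homog_def intro!: pcarrier_single pcarrier_restrict_keys)
  show I': "ideal ?I' (path_algebra G)" by (rule genideal_is_ideal[OF low_carr])
  have "?I \<subseteq> pfilt G 2" using assms by (simp add: admissible_ideal_iff)
  with genideal_superset[of "monomials M \<union> \<rho> ` {..<r}"]
  have gens: "monomials M \<union> \<rho> ` {..<r} \<subseteq> pfilt G 2" by (rule order_trans)
  show "?I' \<subseteq> pfilt G 2"
  proof (rule genideal_least[OF ideal_pfilt])
    have "low i \<in> pfilt G 2" if "i < r" for i
    proof -
      have "\<rho> i \<in> pfilt G 2" using that gens by auto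
      then show ?thesis
        by (simp add: pfilt_def homog_def pcarrier_restrict_keys) metis
    qed
    then show "monomials M \<union> low ` {..<r} \<subseteq> pfilt G 2" using gens by auto
  qed
  obtain N where N: "N \<ge> 2" "pfilt G N \<subseteq> ?I" using assms by (auto simp: admissible_ideal_iff)
  define K where "K = (\<Union>i<r. Poly_Mapping.keys (\<rho> i))"
  have "finite K" by (simp add: K_def)
  \<comment> \<open>\<open>Suc\<close> makes the bound strict, and inserting \<open>N\<close>
    ensures \<open>N \<le> N'\<close> and a nonempty set.\<close>
  define N' where "N' = Max (insert N ((\<lambda>p. Suc (path_length p)) ` K))"
  have N': "path_length p < N'" if "p \<in> K" for p
    using that \<open>finite K\<close> by (auto simp: N'_def less_eq_Suc_le intro!: Max_ge)
  have "N \<le> N'" using \<open>finite K\<close> by (simp add: N'_def)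
  have "(pfilt G N' :: (('a, 'b) path \<Rightarrow>\<^sub>0 'k) set) \<subseteq> monomial_span G M"
  proof
    fix x :: "('a, 'b) path \<Rightarrow>\<^sub>0 'k" assume x: "x \<in> pfilt G N'"
    then have "x \<in> ?I" using N pfilt_antimono[OF \<open>N \<le> N'\<close>, of G] by blast
    then obtain u d where u: "u \<in> monomial_span G M" "x = u + (\<Sum>i<r. scale (d i) (\<rho> i))"
      unfolding genideal_rho by blast
    have "contains_monomial M p" if p: "p \<in> Poly_Mapping.keys x" for p
    proof -
      have "p \<notin> K" using x p N'[of p] by (auto simp: pfilt_def)
      then have "Poly_Mapping.lookup (\<Sum>i<r. scale (d i) (\<rho> i)) p = 0"
        by (auto simp: lookup_sum K_def in_keys_iff intro!: sum.neutral)
      then have "p \<in> Poly_Mapping.keys u" using p u(2) by (simp add: in_keys_iff lookup_add)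
      then show ?thesis using u(1) by (simp add: monomial_span_def)
    qed
    then show "x \<in> monomial_span G M" using x by (simp add: monomial_span_def pfilt_def)
  qed
  also have "monomial_span G M \<subseteq> ?I'"
    using genideal_superset[of "monomials M \<union> low ` {..<r}"]
    by (intro monomial_span_subset_genideal[OF M I']) simp_all
  finally show "\<exists>N\<ge>2. pfilt G N \<subseteq> ?I'"
    using N(1) \<open>N \<le> N'\<close> by (intro exI[of _ N']) simp
qed

end

end

theorem lemma4p11:
  fixes Q :: "('v, 'e) pre_digraph" and v0 \<omega> :: 'v
    and I :: "(('v, 'e) path \<Rightarrow>\<^sub>0 'k::field_char_0) set"
    and a l m n r :: nat
    and \<alpha> \<gamma> :: "nat \<Rightarrow> ('v, 'e) path"
    and B M :: "('v, 'e) path set"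
    and C :: "'k mat"
    and S :: "(('v, 'e) path \<Rightarrow>\<^sub>0 'k) set"
  assumes columns: "\<gamma> = (\<lambda>j. \<alpha> (a + l + m + (j + 1)))"
    and branches: "B = branches Q v0 \<omega>"
    and special: "S = special_basis M \<gamma> C"
    and toupie: "toupie_quiver Q v0 \<omega>"
    and admissible: "admissible_ideal Q I"
    and monomial: "M \<subseteq> quiver_paths Q"
    and matrix: "C \<in> carrier_mat r n" "row_echelon_form C" "vec_space.rank r C = r"
    and non_monomial: "\<And>i. i < r \<Longrightarrow> 2 \<le> card {j. j < n \<and> C $$ (i, j) \<noteq> 0}"
    and generators: "minimal_generators (path_algebra Q) (monomials M \<union> row_relation \<gamma> C ` {..<r}) I"
    and arrows: "a = card {b \<in> B. path_length b = 1}"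
    and free: "l = card {b \<in> B. path_length b > 1 \<and>
                          \<not> contains_monomial M b \<and> b \<notin> involved_branches B \<gamma> C}"
    and mon: "m = card {b \<in> B. contains_monomial M b}"
    and nonmon: "bij_betw \<alpha> {a + l + m + 1..a + l + m + n} (involved_branches B \<gamma> C)"
    and disjoint: "\<And>b. b \<in> involved_branches B \<gamma> C \<Longrightarrow> \<not> contains_monomial M b"
    and ordered: "\<And>i j. a + l + m + 1 \<le> i \<Longrightarrow> i \<le> j \<Longrightarrow> j \<le> a + l + m + n \<Longrightarrow>
                    path_length (\<alpha> j) \<le> path_length (\<alpha> i)"
  shows "(\<forall>\<rho>\<in>S. \<exists>k \<beta> c. ordered_writing Q \<rho> k \<beta> c) \<and>
    (\<forall>k \<beta> c. (\<forall>\<rho>\<in>S. ordered_writing Q \<rho> (k \<rho>) (\<beta> \<rho>) (c \<rho>)) \<longrightarrow>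
       (\<forall>\<rho>\<in>S. \<exists>k0. constant_length_from (k \<rho>) (\<beta> \<rho>) k0) \<and>
       (let I' = Idl\<^bsub>path_algebra Q\<^esub> ((\<lambda>\<rho>. shortest_part (k \<rho>) (\<beta> \<rho>) (c \<rho>)) ` S)
        in admissible_ideal Q I' \<and>
           algebra_isomorphic
             (associated_graded (quotient_algebra (path_algebra Q) I))
             (quotient_algebra (path_algebra Q) I')))"
proof -
  interpret fin_digraph Q
    using toupie by (simp add: toupie_quiver_def)
  have ends: "in_arcs Q v0 = {}" "out_arcs Q \<omega> = {}"
    using toupie by (auto simp: toupie_quiver_def)
  have dims: "dim_row C = r" "dim_col C = n"
    using matrix(1) by auto

  \<comment> \<open>Columns of the matrix as branches\<close>
  have "bij_betw (\<lambda>j. a + l + m + (j + 1)) {..<n} {a + l + m + 1..a + l + m + n}"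
    by (rule bij_betw_byWitness[where f' = "\<lambda>i. i - (a + l + m + 1)"]) auto
  from bij_betw_trans[OF this nonmon] have "bij_betw \<gamma> {..<n} (involved_branches B \<gamma> C)"
    by (simp add: columns comp_def)
  then have \<gamma>_inj: "inj_on \<gamma> {..<n}" and \<gamma>_image: "\<gamma> ` {..<n} = involved_branches B \<gamma> C"
    by (simp_all add: bij_betw_def)
  have \<gamma>_branches: "\<gamma> ` {..<n} \<subseteq> {b \<in> branches Q v0 \<omega>. \<not> contains_monomial M b}"
    using disjoint unfolding \<gamma>_image by (auto simp: involved_branches_def branches)
  then have \<gamma>_paths: "\<gamma> ` {..<n} \<subseteq> quiver_paths Q"
    by (auto simp: branches_def)
  have \<gamma>_mono: "path_length (\<gamma> j) \<le> path_length (\<gamma> i)" if "i \<le> j" "j < n" for i j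
    unfolding columns using that by (intro ordered) auto

  \<comment> \<open>Pivots of the echelon form\<close>
  obtain f where f: "pivot_fun C f n"
    using matrix(2) dims(2) by (auto simp: row_echelon_form_def)
  note pivot = pivot_funD[OF dims(1) f]
  \<comment> \<open>\<open>pivot_fun\<close> allows \<open>f i = n\<close> for a zero row; at least
    two nonzero entries per row exclude this, and \<open>f\<close> is then strictly
    increasing.\<close>
  have f_less: "f i < n" if "i < r" for i
  proof (rule ccontr)
    assume "\<not> f i < n"
    then have "{j. j < n \<and> C $$ (i, j) \<noteq> 0} = {}"
      using pivot(2)[OF that] by auto
    then show False
      using non_monomial[OF that] by (simp only: card.empty)
  qed
  have f_mono: "i < i' \<Longrightarrow> i' < r \<Longrightarrow> f i < f i'" for i i'
  proof (induction i')
    case (Suc i')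
    then have "f i' < f (Suc i')"
      using pivot(3)[of i'] f_less[of "Suc i'"] by simp
    then show ?case
      using Suc by (cases "i = i'") auto
  qed simp

  \<comment> \<open>The special relations\<close>
  define D where "D = special_matrix C"
  have dims_D: "dim_row D = r" "dim_col D = n"
    using special_matrix_induct(2,3)[of "\<lambda>_ _. True" C] by (simp_all add: D_def dims)
  have D_pivot: "D $$ (i, f i) = 1" "\<And>j. j < f i \<Longrightarrow> D $$ (i, j) = 0" if "i < r" for i
    using special_matrix_pivots[of C f i] that f_less f_mono pivot(2,4)
    by (simp_all add: D_def dims)
  define \<rho> where "\<rho> = row_relation \<gamma> D"
  have \<rho>_eq: "\<rho> i = (\<Sum>j<n. Poly_Mapping.single (\<gamma> j) (D $$ (i, j)))" for i
    by (simp add: \<rho>_def row_relation_def dims_D)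
  have \<rho>_keys: "Poly_Mapping.keys (\<rho> i) = \<gamma> ` {j \<in> {..<n}. D $$ (i, j) \<noteq> 0}" for i
    unfolding \<rho>_eq by (rule keys_sum_single_inj[OF \<gamma>_inj finite_lessThan])
  have \<rho>_lookup: "Poly_Mapping.lookup (\<rho> i) (\<gamma> j) = D $$ (i, j)" if "j < n" for i j
    unfolding \<rho>_eq using that by (intro lookup_sum_single_inj[OF \<gamma>_inj]) auto
  have S: "S = monomials M \<union> \<rho> ` {..<r}"
    by (simp add: special special_basis_def \<rho>_def D_def dims)
  have I_eq: "I = Idl\<^bsub>path_algebra Q\<^esub> (monomials M \<union> \<rho> ` {..<r})"
    using genideal_special_matrix[of \<gamma> C M] \<gamma>_paths monomial generators
    by (simp add: \<rho>_def D_def dims minimal_generators_def)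
  \<comment> \<open>The monomials lie in \<open>I\<close>, so admissibility already gives them
    length at least 2.\<close>
  have M_pos: "0 < path_length p" if "p \<in> M" for p
  proof -
    have "Poly_Mapping.single p 1 \<in> I"
      unfolding I_eq using genideal_superset[of "monomials M \<union> \<rho> ` {..<r}"] that
      by (auto simp: monomials_def)
    then have "Poly_Mapping.single p (1 :: 'k) \<in> pfilt Q 2"
      using admissible unfolding admissible_ideal_iff by blast
    then show ?thesis by (simp add: pfilt_def)
  qed
  have \<rho>_branches: "Poly_Mapping.keys (\<rho> i) \<subseteq> {b \<in> branches Q v0 \<omega>. \<not> contains_monomial M b}" for i
    unfolding \<rho>_keys using \<gamma>_branches by blast

  \<comment> \<open>Last nonzero columns and absence of cancellation\<close>
  define q where "q i = Max {j \<in> {..<n}. D $$ (i, j) \<noteq> 0}" for i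
  have q: "q i < n" "D $$ (i, q i) \<noteq> 0" "\<And>j. j < n \<Longrightarrow> D $$ (i, j) \<noteq> 0 \<Longrightarrow> j \<le> q i" if "i < r" for i
  proof -
    have "f i \<in> {j \<in> {..<n}. D $$ (i, j) \<noteq> 0}"
      using f_less[OF that] D_pivot(1)[OF that] by simp
    then have "q i \<in> {j \<in> {..<n}. D $$ (i, j) \<noteq> 0}"
      unfolding q_def by (intro Max_in) auto
    then show "q i < n" "D $$ (i, q i) \<noteq> 0" by simp_all
    show "j \<le> q i" if "j < n" "D $$ (i, j) \<noteq> 0" for j
      unfolding q_def using that by (intro Max_ge) auto
  qed
  have q_inj: "i = i'" if "i < r" "i' < r" "q i = q i'" for i i'
  proof (rule special_matrix_candidate_rows[of "q i" C])
    show "q i < dim_col C" using q that by (simp add: dims)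
    have "k \<in> candidate_rows (special_matrix C) (q k)" if "k < r" for k
      using q[OF that] that unfolding D_def[symmetric] candidate_rows_def
      by (auto simp: dims_D dest: leD)
    from this[OF that(1)] this[OF that(2)]
    show "i \<in> candidate_rows (special_matrix C) (q i)" "i' \<in> candidate_rows (special_matrix C) (q i)"
      by (simp_all only: that(3))
  qed
  \<comment> \<open>Later columns carry paths that are no longer, so the last nonzero column
    realises the minimum.\<close>
  have min_length: "min_length (\<rho> i) = path_length (\<gamma> (q i))" if "i < r" for i
    using q[OF that] \<gamma>_mono by (intro min_length_eqI) (auto simp: \<rho>_keys)
  have independent: "\<exists>p\<in>Poly_Mapping.keys (\<Sum>i<r. scale (d i) (\<rho> i)). path_length p \<le> min_length (\<rho> i)"
    if i: "i < r" "d i \<noteq> 0" for d i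
  proof -
    let ?T = "{i \<in> {..<r}. d i \<noteq> 0}"
    have "finite ?T" "?T \<noteq> {}" using i by auto
    \<comment> \<open>Among the rows used, \<open>k\<close> reaches furthest to the right. All
      others used are zero in column \<open>q k\<close>, so this entry cannot cancel, and its path
      is no longer than any initial form involved.\<close>
    then obtain k where k: "k \<in> ?T" and max: "\<And>i. i \<in> ?T \<Longrightarrow> q i \<le> q k"
      using Max_in[of "q ` ?T"] Max_ge[of "q ` ?T"] by fastforce
    have "Poly_Mapping.lookup (\<Sum>i<r. scale (d i) (\<rho> i)) (\<gamma> (q k)) = (\<Sum>i<r. d i * D $$ (i, q k))"
      using k q(1)[of k] by (simp add: lookup_sum \<rho>_lookup)
    also have "\<dots> = (\<Sum>i<r. if i = k then d k * D $$ (k, q k) else 0)"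
    proof (intro sum.cong refl)
      fix i assume i: "i \<in> {..<r}"
      show "d i * D $$ (i, q k) = (if i = k then d k * D $$ (k, q k) else 0)"
      proof (cases "i = k \<or> d i = 0")
        case False
        then have "q i < q k"
          using i k max[of i] q_inj[of i k] by (auto simp: le_less)
        then have "D $$ (i, q k) = 0"
          using i k q(1)[of k] q(3)[of i "q k"] by force
        then show ?thesis using False by simp
      qed auto
    qed
    also have "\<dots> = d k * D $$ (k, q k)" using k by simp
    finally have "\<gamma> (q k) \<in> Poly_Mapping.keys (\<Sum>i<r. scale (d i) (\<rho> i))"
      using k q(2)[of k] by (simp add: in_keys_iff)
    moreover have "path_length (\<gamma> (q k)) \<le> min_length (\<rho> i)"
      using i k max[of i] q(1)[of k] by (simp add: min_length \<gamma>_mono)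
    ultimately show ?thesis by blast
  qed

  \<comment> \<open>The ideal of initial forms and the isomorphism\<close>
  define low where "low \<rho>' = homog (min_length \<rho>') \<rho>'" for \<rho>' :: "('v, 'e) path \<Rightarrow>\<^sub>0 'k"
  have low_monomial: "low (Poly_Mapping.single p 1) = Poly_Mapping.single p 1" for p
    by (simp add: low_def min_length_def homog_single)
  have low_S: "low ` S = monomials M \<union> (\<lambda>i. low (\<rho> i)) ` {..<r}"
    by (simp add: S image_Un image_image monomials_def low_monomial)
  have low_carrier: "low ` S \<subseteq> pcarrier Q"
  proof -
    have "S \<subseteq> pcarrier Q"
      using monomial \<rho>_branches
      by (fastforce simp: S monomials_def pcarrier_def branches_def)
    then show ?thesis
      by (auto simp: low_def homog_def intro!: pcarrier_restrict_keys)
  qed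
  let ?J = "Idl\<^bsub>path_algebra Q\<^esub> (low ` S)"
  have adm: "admissible_ideal Q ?J"
    unfolding low_S low_def
    by (rule admissible_genideal_low[OF monomial M_pos ends \<rho>_branches independent])
      (use admissible I_eq in simp_all)
  have mem_J_iff: "x \<in> ?J \<longleftrightarrow> (\<forall>t. \<exists>f\<in>pfilt Q (Suc t). homog t x - f \<in> I)"
    if "x \<in> pcarrier Q" for x
    unfolding low_S low_def I_eq
    by (rule genideal_low_iff[where \<rho> = \<rho> and r = r, OF monomial _ ends _ _ that])
      (assumption | rule M_pos \<rho>_branches independent)+
  have iso: "algebra_isomorphic (associated_graded (quotient_algebra (path_algebra Q) I))
      (quotient_algebra (path_algebra Q) ?J)"
  proof -
    interpret admissible_quotient Q I
      by unfold_locales (rule admissible)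
    show ?thesis
    proof (rule associated_graded_isomorphic)
      show "ideal ?J (path_algebra Q)" by (rule genideal_is_ideal[OF low_carrier])
      show "x \<in> ?J \<longleftrightarrow> (\<forall>t. \<exists>f\<in>pfilt Q (Suc t). homog t x - f \<in> I)" if "x \<in> pcarrier Q" for x
        using that by (rule mem_J_iff)
    qed
  qed

  \<comment> \<open>Existence and independence of ordered writings\<close>
  show ?thesis
  proof (intro conjI ballI allI impI)
    fix s assume "s \<in> S"
    then consider p where "p \<in> M" "s = Poly_Mapping.single p 1" | i where "i < r" "s = \<rho> i"
      by (auto simp: S monomials_def)
    then show "\<exists>k \<beta> c. ordered_writing Q s k \<beta> c"
    proof cases
      case 1
      then have "ordered_writing Q s 0 (\<lambda>_. p) (\<lambda>_. 1)"
        using monomial by (auto simp: ordered_writing_def)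
      then show ?thesis by blast
    next
      case 2
      then show ?thesis
        unfolding 2(2) \<rho>_eq
        by (intro ordered_writing_combination[OF \<gamma>_inj \<gamma>_paths \<gamma>_mono, of "f i"] f_less D_pivot)
    qed
  next
    fix k \<beta> c s
    show "\<exists>k0. constant_length_from (k s) (\<beta> s) k0"
      using constant_length_from_last by blast
  next
    fix k \<beta> c
    assume w: "\<forall>s\<in>S. ordered_writing Q s (k s) (\<beta> s) (c s)"
    have "\<forall>s\<in>S. \<exists>d. d \<noteq> 0 \<and> shortest_part (k s) (\<beta> s) (c s) = scale d (low s)"
      unfolding low_def using w shortest_part_eq_homog by metis
    then obtain d where d: "\<forall>s\<in>S. d s \<noteq> 0 \<and> shortest_part (k s) (\<beta> s) (c s) = scale (d s) (low s)"
      by (rule bchoice[THEN exE])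
    have "(\<lambda>s. shortest_part (k s) (\<beta> s) (c s)) ` S = (\<lambda>s. scale (d s) (low s)) ` S"
      using d by (intro image_cong) auto
    \<comment> \<open>The scalars \<open>d s\<close> depend on the writings, but the generated ideal
      is always \<open>?J\<close>, for which admissibility and the isomorphism are known.\<close>
    then have "Idl\<^bsub>path_algebra Q\<^esub> ((\<lambda>s. shortest_part (k s) (\<beta> s) (c s)) ` S) = ?J"
      using genideal_scale[OF low_carrier, of d] d by simp
    then show "let I' = Idl\<^bsub>path_algebra Q\<^esub> ((\<lambda>\<rho>. shortest_part (k \<rho>) (\<beta> \<rho>) (c \<rho>)) ` S)
        in admissible_ideal Q I' \<and>
           algebra_isomorphic
             (associated_graded (quotient_algebra (path_algebra Q) I))
             (quotient_algebra (path_algebra Q) I')"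
      using adm iso by simp
  qed
qed

end
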